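(* Let $\omega=-\frac12+\frac{\sqrt3}{2}i$ and $$b_1=\begin{pmatrix}1&0\\0&\omega\end{pmatrix},\quad b_2=\begin{pmatrix}\frac{1}{\sqrt3}i&\frac{\sqrt2}{\sqrt3}\\-\frac{\sqrt2}{\sqrt3}&-\frac{1}{\sqrt3}i\end{pmatrix},\quad b_3=\begin{pmatrix}-\frac{\sqrt3}{2}i+\frac12k&0\\0&k\end{pmatrix},\quad b_4=\begin{pmatrix}k&0\\0&-k\end{pmatrix}$$ in $U_2(\mathbb{H})$. Then $H_{720}=\langle b_1,b_2,b_3,b_4\rangle$ is an irreducible quaternionic reflection group of order $720$ isomorphic to $2\cdot A_6$, and the six lines spanned by the equal-norm vectors $$\begin{pmatrix}\sqrt2+\sqrt{10}\\ \sqrt3-i+j+\sqrt3k\end{pmatrix},\ \begin{pmatrix}\sqrt2+\sqrt{10}\\ 2i-2j\end{pmatrix},\ \begin{pmatrix}\sqrt2+\sqrt{10}\\ -\sqrt3-i+j-\sqrt3k\end{pmatrix},$$ $$\begin{pmatrix}-\sqrt3-i-j-\sqrt3k\\ \sqrt2+\sqrt{10}\end{pmatrix},\ \begin{pmatrix}2i+2j\\ \sqrt2+\sqrt{10}\end{pmatrix},\ \begin{pmatrix}\sqrt3-i-j+\sqrt3k\\ \sqrt2+\sqrt{10}\end{pmatrix}$$ are six equiangular lines in $\mathbb{H}^2$ with common angle $\frac25$ which form a single orbit of lines under $H_{720}$. Moreover, these six lines also form a single orbit of lines under the subgroup $H_{24}=\langle b_1,b_2\rangle$, which has order $24$ and is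 the complex reflection group with Shephard-Todd number $4$; and the orbit under $H_{24}$ of the line spanned by $e_1=(1,0)$ consists of four equiangular lines in $\mathbb{C}^2$.
   Context: $\mathbb{H}$ denotes the quaternions with units $i,j,k$. $\mathbb{H}^d$ is a right $\mathbb{H}$-vector space; matrices act on the left. The inner product is $\langle v,w\rangle=\sum_j\overline{v_j}w_j$, and $U_d(\mathbb{H})$ is the group of $d\times d$ quaternionic matrices preserving it. A line is a one-dimensional right $\mathbb{H}$-subspace $v\mathbb{H}$ (for lines in $\mathbb{C}^2$: a one-dimensional complex subspace). Lines are equiangular with common angle $\lambda$ if, for unit vectors spanning them, $|\langle v_a,v_b\rangle|^2=\lambda$ for all pairs of distinct lines. A quaternionic reflection is a nonidentity $g\in U_d(\mathbb{H})$ which fixes pointwise a subspace of dimension $d-1$; a quaternionic reflection group is a group generated by quaternionic reflections. It is irreducible if the only invariant right $\mathbb{H}$-subspaces are $0$ and $\mathbb{H}^d$. $2\cdot A_6$ is the double cover of the alternating group $A_6$. The orbit of a line $L$ under a group $G$ is $\{gL:g\in G\}$. *)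

theory Defs
  imports
    "HOL-Analysis.Analysis"
    "HOL-Algebra.Elementary_Groups"
    "HOL-Algebra.Generated_Groups"
    "HOL-Algebra.Sym_Groups"
begin

section \<open>Quaternions\<close>

text \<open>\<open>Quat a b c d\<close> is the quaternion \<open>a + b i + c j + d k\<close>.\<close>

datatype quat = Quat (qre: real) (qi: real) (qj: real) (qk: real)

lemma quat_eq_iff: "x = y \<longleftrightarrow> qre x = qre y \<and> qi x = qi y \<and> qj x = qj y \<and> qk x = qk y"
  by (cases x; cases y) auto

class involutive_div_algebra = real_normed_div_algebra +
  fixes conjugate :: "'a \<Rightarrow> 'a"
  assumes conjugate_add: "conjugate (x + y) = conjugate x + conjugate y"
    and conjugate_mult: "conjugate (x * y) = conjugate y * conjugate x"
    and conjugate_conjugate: "conjugate (conjugate x) = x"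
    and conjugate_self: "conjugate x * x = (norm x)\<^sup>2 *\<^sub>R 1"

instantiation complex :: involutive_div_algebra
begin

definition conjugate_complex :: "complex \<Rightarrow> complex" where
  "conjugate_complex = cnj"

instance
  by standard (auto simp: conjugate_complex_def scaleR_conv_of_real complex_norm_square mult.commute
      simp del: of_real_power)

end

instantiation quat :: involutive_div_algebra
begin

definition "0 = Quat 0 0 0 0"

definition "1 = Quat 1 0 0 0"

definition "x + y = Quat (qre x + qre y) (qi x + qi y) (qj x + qj y) (qk x + qk y)"

definition "x - y = Quat (qre x - qre y) (qi x - qi y) (qj x - qj y) (qk x - qk y)"

definition "- x = Quat (- qre x) (- qi x) (- qj x) (- qk x)"

definition "x * y = Quat
   (qre x * qre y - qi x * qi y - qj x * qj y - qk x * qk y)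
   (qre x * qi y + qi x * qre y + qj x * qk y - qk x * qj y)
   (qre x * qj y - qi x * qk y + qj x * qre y + qk x * qi y)
   (qre x * qk y + qi x * qj y - qj x * qi y + qk x * qre y)"

definition "r *\<^sub>R x = Quat (r * qre x) (r * qi x) (r * qj x) (r * qk x)"

definition conjugate_quat :: "quat \<Rightarrow> quat" where
  "conjugate x = Quat (qre x) (- qi x) (- qj x) (- qk x)"

definition norm_quat :: "quat \<Rightarrow> real" where
  "norm x = sqrt ((qre x)\<^sup>2 + (qi x)\<^sup>2 + (qj x)\<^sup>2 + (qk x)\<^sup>2)"

definition inverse_quat :: "quat \<Rightarrow> quat" where
  "inverse (x :: quat) = (1 / (norm x)\<^sup>2) *\<^sub>R conjugate x"

definition "x div (y :: quat) = x * inverse y"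

definition sgn_quat :: "quat \<Rightarrow> quat" where
  "sgn (x :: quat) = inverse (norm x) *\<^sub>R x"

definition dist_quat :: "quat \<Rightarrow> quat \<Rightarrow> real" where
  "dist x (y :: quat) = norm (x - y)"

definition uniformity_quat :: "(quat \<times> quat) filter" where
  "uniformity = (INF e\<in>{0 <..}. principal {(x :: quat, y :: quat). dist x y < e})"

definition open_quat :: "quat set \<Rightarrow> bool" where
  "open (U :: quat set) \<longleftrightarrow> (\<forall>x\<in>U. eventually (\<lambda>(x', y). x' = x \<longrightarrow> y \<in> U) uniformity)"

lemmas quat_ring_defs = zero_quat_def one_quat_def plus_quat_def minus_quat_def
  uminus_quat_def times_quat_def scaleR_quat_def conjugate_quat_def

lemma norm_quat_power2: "(norm x)\<^sup>2 = (qre x)\<^sup>2 + (qi x)\<^sup>2 + (qj x)\<^sup>2 + (qk x)\<^sup>2" for x :: quat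
  by (simp add: norm_quat_def)

lemma norm_quat_complex:
  "norm x = norm (Complex (qre x) (qi x), Complex (qj x) (qk x))" for x :: quat
  by (simp add: norm_quat_def norm_prod_def cmod_def add.assoc)

lemma norm_quat_eq_0: "norm x = 0 \<longleftrightarrow> x = 0" for x :: quat
  by (simp add: norm_quat_complex zero_quat_def quat_eq_iff zero_prod_def complex_eq_iff)

lemma conjugate_mult_self_quat: "conjugate x * x = (norm x)\<^sup>2 *\<^sub>R 1" for x :: quat
  unfolding norm_quat_power2 by (simp add: quat_ring_defs power2_eq_square)

lemma mult_conjugate_self_quat: "x * conjugate x = (norm x)\<^sup>2 *\<^sub>R 1" for x :: quat
  unfolding norm_quat_power2 by (simp add: quat_ring_defs power2_eq_square)

instance
proof
  fix x y z :: quat and r s :: real and U :: "quat set"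
  show "x + y + z = x + (y + z)" "x + y = y + x" "0 + x = x" "- x + x = 0" "x - y = x + - y"
    "x * y * z = x * (y * z)" "1 * x = x" "x * 1 = x"
    "(x + y) * z = x * z + y * z" "x * (y + z) = x * y + x * z"
    "(0 :: quat) \<noteq> 1"
    "r *\<^sub>R (x + y) = r *\<^sub>R x + r *\<^sub>R y" "(r + s) *\<^sub>R x = r *\<^sub>R x + s *\<^sub>R x"
    "r *\<^sub>R s *\<^sub>R x = (r * s) *\<^sub>R x" "1 *\<^sub>R x = x"
    "r *\<^sub>R x * y = r *\<^sub>R (x * y)" "x * r *\<^sub>R y = r *\<^sub>R (x * y)"
    "conjugate (x + y) = conjugate x + conjugate y"
    "conjugate (x * y) = conjugate y * conjugate x"
    "conjugate (conjugate x) = x"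
    by (simp_all add: quat_ring_defs algebra_simps)
  show "x div y = x * inverse y"
    by (fact divide_quat_def)
  show "dist x y = norm (x - y)"
    by (fact dist_quat_def)
  show "sgn x = inverse (norm x) *\<^sub>R x"
    by (fact sgn_quat_def)
  show "uniformity = (INF e\<in>{0 <..}. principal {(x :: quat, y :: quat). dist x y < e})"
    by (fact uniformity_quat_def)
  show "open U \<longleftrightarrow> (\<forall>x\<in>U. eventually (\<lambda>(x', y). x' = x \<longrightarrow> y \<in> U) uniformity)"
    by (fact open_quat_def)
  show "inverse (0 :: quat) = 0"
    by (simp add: inverse_quat_def quat_ring_defs)
  show "norm x = 0 \<longleftrightarrow> x = 0"
    by (fact norm_quat_eq_0)
  show "norm (x + y) \<le> norm x + norm y"
    using norm_triangle_ineq[of "(Complex (qre x) (qi x), Complex (qj x) (qk x))"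
        "(Complex (qre y) (qi y), Complex (qj y) (qk y))"]
    by (simp add: norm_quat_complex plus_quat_def complex_add)
  show "norm (r *\<^sub>R x) = \<bar>r\<bar> * norm x"
    by (simp add: norm_quat_def scaleR_quat_def power_mult_distrib real_sqrt_mult
        flip: distrib_left)
  show "norm (x * y) = norm x * norm y"
    by (simp add: norm_quat_def times_quat_def power2_eq_square algebra_simps
        flip: real_sqrt_mult)
  {
    assume "x \<noteq> 0"
    then have n: "(norm x)\<^sup>2 \<noteq> 0"
      by (simp add: norm_quat_eq_0)
    have "(1 / (norm x)\<^sup>2) *\<^sub>R (conjugate x * x) = 1"
      unfolding conjugate_mult_self_quat using n by (simp add: scaleR_quat_def one_quat_def)
    then show "inverse x * x = 1"
      unfolding inverse_quat_def by (simp add: quat_ring_defs algebra_simps)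
    have "(1 / (norm x)\<^sup>2) *\<^sub>R (x * conjugate x) = 1"
      unfolding mult_conjugate_self_quat using n by (simp add: scaleR_quat_def one_quat_def)
    then show "x * inverse x = 1"
      unfolding inverse_quat_def by (simp add: quat_ring_defs algebra_simps)
  }
  show "conjugate x * x = (norm x)\<^sup>2 *\<^sub>R 1"
    by (fact conjugate_mult_self_quat)
qed

end

section \<open>Lines and unitary groups over the complex numbers and the quaternions\<close>

text \<open>
  The definitions below are uniform in the division algebra. Matrices act on column vectors from
  the left by \<open>(*v)\<close>, scalars act from the right.
\<close>

definition hinner :: "'a::involutive_div_algebra ^ 'n \<Rightarrow> 'a ^ 'n \<Rightarrow> 'a" where
  "hinner v w = (\<Sum>j\<in>UNIV. conjugate (v $ j) * w $ j)"

definition rscale :: "'a::ring_1 ^ 'n \<Rightarrow> 'a \<Rightarrow> 'a ^ 'n" where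
  "rscale v c = (\<chi> j. v $ j * c)"

definition right_subspace :: "('a::ring_1 ^ 'n) set \<Rightarrow> bool" where
  "right_subspace W \<longleftrightarrow>
     0 \<in> W \<and> (\<forall>v\<in>W. \<forall>w\<in>W. v + w \<in> W) \<and> (\<forall>v\<in>W. \<forall>c. rscale v c \<in> W)"

definition right_basis :: "('a::ring_1 ^ 'n) set \<Rightarrow> ('a ^ 'n) set \<Rightarrow> bool" where
  "right_basis B W \<longleftrightarrow> finite B \<and> B \<subseteq> W \<and>
     (\<forall>w\<in>W. \<exists>c. w = (\<Sum>b\<in>B. rscale b (c b))) \<and>
     (\<forall>c. (\<Sum>b\<in>B. rscale b (c b)) = 0 \<longrightarrow> (\<forall>b\<in>B. c b = 0))"

definition has_right_dim :: "('a::ring_1 ^ 'n) set \<Rightarrow> nat \<Rightarrow> bool" where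
  "has_right_dim W k \<longleftrightarrow> right_subspace W \<and> (\<exists>B. right_basis B W \<and> card B = k)"

definition line_of :: "'a::ring_1 ^ 'n \<Rightarrow> ('a ^ 'n) set" where
  "line_of v = range (rscale v)"

definition is_line :: "('a::ring_1 ^ 'n) set \<Rightarrow> bool" where
  "is_line L \<longleftrightarrow> (\<exists>v. v \<noteq> 0 \<and> L = line_of v)"

definition equiangular :: "real \<Rightarrow> ('a::involutive_div_algebra ^ 'n) set set \<Rightarrow> bool" where
  "equiangular angle Ls \<longleftrightarrow> (\<forall>L\<in>Ls. is_line L) \<and>
     (\<forall>L\<in>Ls. \<forall>M\<in>Ls. L \<noteq> M \<longrightarrow>
       (\<forall>v w. hinner v v = 1 \<and> hinner w w = 1 \<and> L = line_of v \<and> M = line_of w \<longrightarrow>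
         (norm (hinner v w))\<^sup>2 = angle))"

definition unitary_group :: "('a::involutive_div_algebra ^ 'n ^ 'n) monoid" where
  "unitary_group =
     \<lparr>carrier = {A. \<forall>v w. hinner (A *v v) (A *v w) = hinner v w},
      mult = (**), one = mat 1\<rparr>"

definition line_orbit ::
  "('a::ring_1 ^ 'n ^ 'n) monoid \<Rightarrow> ('a ^ 'n) set \<Rightarrow> ('a ^ 'n) set set" where
  "line_orbit G L = (\<lambda>A. (*v) A ` L) ` carrier G"

definition reflection :: "'a::involutive_div_algebra ^ 'n ^ 'n \<Rightarrow> bool" where
  "reflection A \<longleftrightarrow> A \<in> carrier unitary_group \<and> A \<noteq> mat 1 \<and>
     (\<exists>W. has_right_dim W (CARD('n) - 1) \<and> (\<forall>w\<in>W. A *v w = w))"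

definition reflection_group :: "('a::involutive_div_algebra ^ 'n ^ 'n) monoid \<Rightarrow> bool" where
  "reflection_group G \<longleftrightarrow>
     (\<exists>R. (\<forall>A\<in>R. reflection A) \<and> G = subgroup_generated unitary_group R)"

definition irreducible_group :: "('a::ring_1 ^ 'n ^ 'n) monoid \<Rightarrow> bool" where
  "irreducible_group G \<longleftrightarrow>
     (\<forall>W. right_subspace W \<and> (\<forall>A\<in>carrier G. (*v) A ` W \<subseteq> W) \<longrightarrow> W = {0} \<or> W = UNIV)"

definition mat2 :: "'a::zero \<Rightarrow> 'a \<Rightarrow> 'a \<Rightarrow> 'a \<Rightarrow> 'a ^ 2 ^ 2" where
  "mat2 a b c d = vector [vector [a, b], vector [c, d]]"


section \<open>The double cover of the alternating group on six letters\<close>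

text \<open>
  \<open>2\<cdot>A\<^sub>6\<close> is the double cover of \<open>A\<^sub>6\<close>: the central extension with kernel of order 2 whose kernel
  lies in the derived subgroup. It is unique up to isomorphism, because the Schur multiplier of
  \<open>A\<^sub>6\<close> is cyclic of order 6. The condition on the derived subgroup excludes \<open>2 \<times> A\<^sub>6\<close>.
\<close>

definition double_cover :: "('g, 'x) monoid_scheme \<Rightarrow> ('h, 'y) monoid_scheme \<Rightarrow> bool" where
  "double_cover G A \<longleftrightarrow> group G \<and> group A \<and>
     (\<exists>\<pi> \<in> epi G A. card (kernel G A \<pi>) = 2 \<and>
        (\<forall>z \<in> kernel G A \<pi>. \<forall>g \<in> carrier G. z \<otimes>\<^bsub>G\<^esub> g = g \<otimes>\<^bsub>G\<^esub> z) \<and>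
        kernel G A \<pi> \<subseteq> derived G (carrier G))"


section \<open>The Shephard--Todd group number 4\<close>

text \<open>
  Shephard and Todd obtain their groups 4 to 7 from Klein's generators \<open>S\<^sub>1\<close>, \<open>T\<^sub>1\<close> of the binary
  tetrahedral group, as \<open>\<langle>\<lambda> S\<^sub>1, \<mu> T\<^sub>1\<rangle>\<close>; number 4 is the case \<open>\<lambda> = -1\<close>, \<open>\<mu> = -\<omega>\<close>. The numbering
  is one of groups up to conjugation in \<open>GL\<^sub>2(\<complex>)\<close>.
\<close>

definition klein_S1 :: "complex ^ 2 ^ 2" where
  "klein_S1 = mat2 \<i> 0 0 (- \<i>)"

definition klein_T1 :: "complex ^ 2 ^ 2" where
  "klein_T1 = (let \<epsilon> = cis (pi / 4)
     in mat2 (\<epsilon> / sqrt 2) (\<epsilon> ^ 3 / sqrt 2) (\<epsilon> / sqrt 2) (\<epsilon> ^ 7 / sqrt 2))"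

definition shephard_todd_tetrahedral :: "complex \<Rightarrow> complex \<Rightarrow> (complex ^ 2 ^ 2) monoid" where
  "shephard_todd_tetrahedral s t =
     subgroup_generated unitary_group {mat s ** klein_S1, mat t ** klein_T1}"

definition shephard_todd_4 :: "(complex ^ 2 ^ 2) monoid" where
  "shephard_todd_4 = shephard_todd_tetrahedral (- 1) (- cis (2 * pi / 3))"

definition has_shephard_todd_number_4 :: "(complex ^ 2 ^ 2) monoid \<Rightarrow> bool" where
  "has_shephard_todd_number_4 K \<longleftrightarrow>
     (\<exists>P. invertible P \<and> carrier K = (\<lambda>A. P ** A ** matrix_inv P) ` carrier shephard_todd_4)"


section \<open>Complex matrices inside the quaternionic ones\<close>

definition quat_of_complex :: "complex \<Rightarrow> quat" where
  "quat_of_complex z = Quat (Re z) (Im z) 0 0"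

definition quat_matrix :: "complex ^ 'n ^ 'n \<Rightarrow> quat ^ 'n ^ 'n" where
  "quat_matrix A = (\<chi> r c. quat_of_complex (A $ r $ c))"

definition complex_matrices_of :: "(quat ^ 'n ^ 'n) monoid \<Rightarrow> (complex ^ 'n ^ 'n) monoid" where
  "complex_matrices_of G = unitary_group \<lparr>carrier := {A. quat_matrix A \<in> carrier G}\<rparr>"


section \<open>The groups and lines in question\<close>

definition b1 :: "quat ^ 2 ^ 2" where
  "b1 = mat2 1 0 0 (Quat (- 1 / 2) (sqrt 3 / 2) 0 0)"

definition b2 :: "quat ^ 2 ^ 2" where
  "b2 = mat2 (Quat 0 (1 / sqrt 3) 0 0) (Quat (sqrt 2 / sqrt 3) 0 0 0)
             (Quat (- (sqrt 2 / sqrt 3)) 0 0 0) (Quat 0 (- (1 / sqrt 3)) 0 0)"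

definition b3 :: "quat ^ 2 ^ 2" where
  "b3 = mat2 (Quat 0 (- (sqrt 3 / 2)) 0 (1 / 2)) 0 0 (Quat 0 0 0 1)"

definition b4 :: "quat ^ 2 ^ 2" where
  "b4 = mat2 (Quat 0 0 0 1) 0 0 (Quat 0 0 0 (- 1))"

definition H720 :: "(quat ^ 2 ^ 2) monoid" where
  "H720 = subgroup_generated unitary_group {b1, b2, b3, b4}"

definition H24 :: "(quat ^ 2 ^ 2) monoid" where
  "H24 = subgroup_generated unitary_group {b1, b2}"

definition six_vectors :: "(quat ^ 2) list" where
  "six_vectors = (let a = Quat (sqrt 2 + sqrt 10) 0 0 0 in
     [vector [a, Quat (sqrt 3) (- 1) 1 (sqrt 3)],
      vector [a, Quat 0 2 (- 2) 0],
      vector [a, Quat (- sqrt 3) (- 1) 1 (- sqrt 3)],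
      vector [Quat (- sqrt 3) (- 1) (- 1) (- sqrt 3), a],
      vector [Quat 0 2 2 0, a],
      vector [Quat (sqrt 3) (- 1) (- 1) (sqrt 3), a]])"

definition six_lines :: "(quat ^ 2) set set" where
  "six_lines = line_of ` set six_vectors"

end

theory Submission
  imports Defs
begin

text \<open>
  \<open>H720\<close> permutes the six lines by even permutations. This homomorphism to \<open>A\<^sub>6\<close> has kernel
  \<open>{1, -1}\<close>, and its image contains a 3-cycle together with all its conjugates, hence all of
  \<open>A\<^sub>6\<close>; so the order is \<open>2 \<cdot> 360\<close>. Moreover \<open>-1\<close> is a commutator of two elements of
  order 4 in \<open>H24\<close>, whose image has order 12. The conjugates of \<open>b1\<close> are reflections; \<open>b2\<close> is a
  product of them, hence so is \<open>-1 = b2\<^sup>2\<close>, and suitable products have the same permutations as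
  \<open>b3\<close> and \<open>b4\<close>, hence agree with these up to \<open>-1\<close>.
\<close>

section \<open>Unitary matrices\<close>

definition cadjoint :: "'a::involutive_div_algebra ^ 'n ^ 'n \<Rightarrow> 'a ^ 'n ^ 'n" where
  "cadjoint A = (\<chi> i j. conjugate (A $ j $ i))"

lemma conjugate_zero [simp]: "conjugate (0 :: 'a::involutive_div_algebra) = 0"
  using conjugate_add[of "0 :: 'a" 0] by simp

lemma conjugate_one [simp]: "conjugate (1 :: 'a::involutive_div_algebra) = 1"
  using conjugate_mult[of "conjugate (1 :: 'a)" 1] by (simp add: conjugate_conjugate)

lemma conjugate_sum: "conjugate (sum f S) = (\<Sum>i\<in>S. conjugate (f i :: 'a::involutive_div_algebra))"
  by (induction S rule: infinite_finite_induct) (auto simp: conjugate_add)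

lemma conjugate_eq_0_iff [simp]: "conjugate x = 0 \<longleftrightarrow> (x :: 'a::involutive_div_algebra) = 0"
  by (metis conjugate_conjugate conjugate_zero)

lemma norm_conjugate [simp]: "norm (conjugate x) = norm (x :: 'a::involutive_div_algebra)"
proof (cases "x = 0")
  case False
  have "norm (conjugate x) * norm x = norm x * norm x"
    using arg_cong[OF conjugate_self[of x], of norm] by (simp add: norm_mult power2_eq_square)
  with False show ?thesis
    by simp
qed simp

lemma self_conjugate: "x * conjugate x = (norm x)\<^sup>2 *\<^sub>R (1 :: 'a::involutive_div_algebra)"
  using conjugate_self[of "conjugate x"] by (simp add: conjugate_conjugate)

lemma hinner_matrix_vector_mult:
  "hinner (A *v v) w = hinner v (cadjoint A *v w)"
  unfolding hinner_def cadjoint_def matrix_vector_mult_def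
  by (simp add: conjugate_sum conjugate_mult sum_distrib_left sum_distrib_right mult.assoc)
    (rule sum.swap)

lemma hinner_axis_axis: "hinner (axis i 1) (A *v axis j 1) = A $ i $ j"
  for A :: "'a::involutive_div_algebra ^ 'n ^ 'n"
proof -
  have *: "A *v axis j 1 = column j A"
    by (simp add: vec_eq_iff matrix_vector_mult_def axis_def column_def if_distrib cong: if_cong)
  have "conjugate (axis i 1 $ k) * (column j A) $ k = (if k = i then A $ i $ j else 0)" for k
    by (simp add: axis_def column_def)
  then show ?thesis
    unfolding * hinner_def by simp
qed

text \<open>The entries of a matrix are its inner products with the coordinate vectors, so
  preserving all inner products is a single matrix equation.\<close>

lemma unitary_iff: "A \<in> carrier unitary_group \<longleftrightarrow> cadjoint A ** A = mat 1"
proof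
  assume "A \<in> carrier unitary_group"
  then have *: "hinner v ((cadjoint A ** A) *v w) = hinner v w" for v w
    by (simp add: unitary_group_def hinner_matrix_vector_mult matrix_vector_mul_assoc)
  show "cadjoint A ** A = mat 1"
    unfolding vec_eq_iff
    using hinner_axis_axis[of _ "cadjoint A ** A"] hinner_axis_axis[of _ "mat 1"] *
    by (metis matrix_vector_mul_lid)
qed (simp add: unitary_group_def hinner_matrix_vector_mult matrix_vector_mul_assoc)

section \<open>Calculus of matrices of size two\<close>

lemma matrix_eq2:
  "A = B \<longleftrightarrow> A$1$1 = B$1$1 \<and> A$1$2 = B$1$2 \<and> A$2$1 = B$2$1 \<and> A$2$2 = B$2$2"
  for A B :: "'a ^ 2 ^ 2"
  by (auto simp: vec_eq_iff forall_2)

lemma mat2_nth [simp]: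
  "mat2 a b c d $ 1 $ 1 = a" "mat2 a b c d $ 1 $ 2 = b"
  "mat2 a b c d $ 2 $ 1 = c" "mat2 a b c d $ 2 $ 2 = d"
  by (simp_all add: mat2_def)

lemma mat2_cases: obtains a b c d where "A = mat2 a b c d"
  using that[of "A$1$1" "A$1$2" "A$2$1" "A$2$2"] by (simp add: matrix_eq2)

lemma mat_eq_mat2: "mat x = mat2 x 0 0 (x :: 'a::zero)"
  by (simp add: matrix_eq2 mat_def)

lemma uminus_mat2: "- mat2 a b c d = mat2 (- a) (- b) (- c) (- d :: 'a::group_add)"
  by (simp add: matrix_eq2)

lemma mat2_mult:
  "mat2 a b c d ** mat2 a' b' c' d' =
     mat2 (a * a' + b * c') (a * b' + b * d') (c * a' + d * c') (c * b' + d * (d' :: 'a::semiring_1))"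
  by (simp add: matrix_eq2 matrix_matrix_mult_def sum_2)

lemma mat2_vector:
  "mat2 a b c d *v vector [x, y] = vector [a * x + b * y, c * x + d * (y :: 'a::semiring_1)]"
  by (simp add: vec_eq_iff forall_2 matrix_vector_mult_def sum_2)

lemma cadjoint_mat2:
  "cadjoint (mat2 a b c d) = mat2 (conjugate a) (conjugate c) (conjugate b) (conjugate d)"
  by (simp add: matrix_eq2 cadjoint_def)

lemma mat2_eq_iff: "mat2 a b c d = mat2 a' b' c' d' \<longleftrightarrow> a = a' \<and> b = b' \<and> c = c' \<and> d = d'"
  by (simp add: matrix_eq2)

lemma vector2_eq_iff: "(vector [x, y] :: 'a::zero ^ 2) = vector [x', y'] \<longleftrightarrow> x = x' \<and> y = y'"
  by (simp add: vec_eq_iff forall_2)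

lemma vector2_cases: obtains x y where "v = (vector [x, y] :: 'a::zero ^ 2)"
  using that[of "v $ 1" "v $ 2"] by (simp add: vec_eq_iff forall_2)

lemma hinner_vector2:
  "hinner (vector [x, y] :: _ ^ 2) (vector [x', y']) = conjugate x * x' + conjugate y * y'"
  by (simp add: hinner_def sum_2)

text \<open>Norms in the column relations give |a| = |d| and |b| = |c|, so the rows are unit
  vectors. Orthogonality of the rows follows from that of the columns after cancelling
  \<open>conjugate a\<close>; if \<open>a\<close> vanishes, so does \<open>d\<close>. This is what
  closes the unitary matrices under \<open>cadjoint\<close>.\<close>

lemma cadjoint_right_inverse:
  fixes A :: "'a::involutive_div_algebra ^ 2 ^ 2"
  assumes "cadjoint A ** A = mat 1"
  shows "A ** cadjoint A = mat 1"
proof -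
  obtain a b c d where A: "A = mat2 a b c d"
    by (rule mat2_cases)
  have ac: "conjugate a * a + conjugate c * c = 1" and bd: "conjugate b * b + conjugate d * d = 1"
    and off: "conjugate a * b + conjugate c * d = 0"
    using assms by (simp_all add: A cadjoint_mat2 mat2_mult mat_eq_mat2 mat2_eq_iff)
  have scaleR1: "r = 1" if "r *\<^sub>R (1 :: 'a) = 1" for r :: real
    using that by (metis of_real_def of_real_eq_1_iff)
  have nac: "(norm a)\<^sup>2 + (norm c)\<^sup>2 = 1" and nbd: "(norm b)\<^sup>2 + (norm d)\<^sup>2 = 1"
    using ac bd by (auto intro!: scaleR1 simp: conjugate_self scaleR_add_left)
  have "norm (conjugate a * b) = norm (conjugate c * d)"
    using off by (metis add.inverse_unique norm_minus_cancel)
  then have "norm a * norm b = norm c * norm d"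
    by (simp add: norm_mult)
  then have "(norm a)\<^sup>2 * (norm b)\<^sup>2 = (norm c)\<^sup>2 * (norm d)\<^sup>2"
    by (metis power_mult_distrib)
  moreover have "(norm b)\<^sup>2 = 1 - (norm d)\<^sup>2" "(norm c)\<^sup>2 = 1 - (norm a)\<^sup>2"
    using nac nbd by auto
  ultimately have ad: "(norm a)\<^sup>2 = (norm d)\<^sup>2"
    by (simp add: algebra_simps)
  then have cb: "(norm c)\<^sup>2 = (norm b)\<^sup>2"
    using nac nbd by linarith
  have off': "a * conjugate c + b * conjugate d = 0"
  proof (cases "a = 0")
    case True
    with ad show ?thesis
      by simp
  next
    case False
    have "conjugate a * (a * conjugate c + b * conjugate d) =
        (conjugate a * a) * conjugate c + (conjugate a * b) * conjugate d"
      by (simp add: algebra_simps)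
    also have "conjugate a * b = - (conjugate c * d)"
      using off by (simp add: add_eq_0_iff2)
    also have "(conjugate a * a) * conjugate c + - (conjugate c * d) * conjugate d =
        (conjugate a * a) * conjugate c - conjugate c * (d * conjugate d)"
      by (simp add: algebra_simps)
    finally show ?thesis
      using False by (simp add: conjugate_self self_conjugate ad)
  qed
  then have "conjugate (a * conjugate c + b * conjugate d) = 0"
    by simp
  then have "c * conjugate a + d * conjugate b = 0"
    by (simp add: conjugate_add conjugate_mult conjugate_conjugate)
  moreover have "a * conjugate a + b * conjugate b = 1" "c * conjugate c + d * conjugate d = 1"
    using nac nbd ad cb by (simp_all add: self_conjugate add.commute flip: scaleR_add_left)
  ultimately show ?thesis
    using off' by (simp add: A cadjoint_mat2 mat2_mult mat_eq_mat2 mat2_eq_iff)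
qed

lemma cadjoint_cadjoint [simp]: "cadjoint (cadjoint A) = A"
  by (simp add: cadjoint_def vec_eq_iff conjugate_conjugate)

lemma mult_unitary_group [simp]: "mult unitary_group = (**)"
  and one_unitary_group [simp]: "one unitary_group = mat 1"
  by (simp_all add: unitary_group_def)

lemma group_unitary_group:
  "group (unitary_group :: ('a::involutive_div_algebra ^ 2 ^ 2) monoid)"
proof (rule groupI)
  fix A :: "'a ^ 2 ^ 2"
  assume "A \<in> carrier unitary_group"
  then show "\<exists>B\<in>carrier unitary_group. B \<otimes>\<^bsub>unitary_group\<^esub> A = \<one>\<^bsub>unitary_group\<^esub>"
    by (intro bexI[of _ "cadjoint A"]) (simp_all add: unitary_iff cadjoint_right_inverse)
qed (simp_all add: unitary_group_def matrix_mul_assoc flip: matrix_vector_mul_assoc)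

interpretation U: group "unitary_group :: ('a::involutive_div_algebra ^ 2 ^ 2) monoid"
  rewrites "mult (unitary_group :: ('a ^ 2 ^ 2) monoid) = (**)"
    and "one (unitary_group :: ('a ^ 2 ^ 2) monoid) = mat 1"
  by (simp_all add: group_unitary_group)

section \<open>Lines\<close>

lemma matrix_vector_mult_rscale: "A *v rscale v c = rscale (A *v v) c"
  by (simp add: rscale_def matrix_vector_mult_def vec_eq_iff sum_distrib_right mult.assoc)

lemma rscale_rscale [simp]: "rscale (rscale v c) d = rscale v (c * d)"
  by (simp add: rscale_def vec_eq_iff mult.assoc)

lemma rscale_one [simp]: "rscale v 1 = v"
  by (simp add: rscale_def vec_eq_iff)

lemma rscale_vector2: "rscale (vector [x, y] :: 'a::ring_1 ^ 2) c = vector [x * c, y * c]"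
  by (simp add: rscale_def vec_eq_iff forall_2)

lemma rscale_eq_0_iff: "rscale v c = 0 \<longleftrightarrow> v = 0 \<or> (c :: 'a::division_ring) = 0"
  by (auto simp: rscale_def vec_eq_iff)

lemma rscale_add: "rscale v (c + d) = rscale v c + rscale v d"
  by (simp add: rscale_def vec_eq_iff distrib_left)

lemma image_line_of: "(*v) A ` line_of v = line_of (A *v v)"
  by (auto simp: line_of_def matrix_vector_mult_rscale image_image)

lemma line_of_self: "v \<in> line_of v"
  by (metis line_of_def rangeI rscale_one)

lemma line_of_rscale:
  assumes "(c :: 'a::division_ring) \<noteq> 0"
  shows "line_of (rscale v c) = line_of v"
proof -
  have "rscale v d \<in> range (rscale (rscale v c))" for d
    using assms by (intro range_eqI[of _ _ "inverse c * d"]) (simp flip: mult.assoc)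
  then show ?thesis
    by (auto simp: line_of_def)
qed

lemma line_of_eqD:
  assumes "line_of v = line_of w"
  obtains c where "v = rscale w c"
  using assms line_of_self[of v] that by (auto simp: line_of_def)

lemma has_right_dim_line_of:
  fixes v :: "'a::division_ring ^ 'n"
  assumes "v \<noteq> 0"
  shows "has_right_dim (line_of v) 1"
proof -
  have "right_subspace (line_of v)"
    unfolding right_subspace_def line_of_def
    by (auto simp flip: rscale_add) (metis rangeI rscale_eq_0_iff)
  moreover have "right_basis {v} (line_of v)"
    using assms line_of_self[of v]
    by (auto simp: right_basis_def rscale_eq_0_iff) (auto simp: line_of_def)
  ultimately show ?thesis
    unfolding has_right_dim_def by (intro conjI exI[of _ "{v}"]) auto
qed

text \<open>In dimension two the required fixed subspace is a line, so one nonzero fixed vector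
  suffices.\<close>

lemma reflectionI:
  fixes A :: "'a::involutive_div_algebra ^ 2 ^ 2"
  assumes "A \<in> carrier unitary_group" "A \<noteq> mat 1" "v \<noteq> 0" "A *v v = v"
  shows "reflection A"
proof -
  have "\<forall>w\<in>line_of v. A *v w = w"
    using assms by (auto simp: line_of_def matrix_vector_mult_rscale)
  then show ?thesis
    unfolding reflection_def using assms has_right_dim_line_of[of v] by auto
qed

lemma hinner_rscale: "hinner (rscale v c) (rscale w d) = conjugate c * hinner v w * d"
  by (simp add: hinner_def rscale_def conjugate_mult sum_distrib_left sum_distrib_right mult.assoc)

text \<open>Rescaling a spanning vector multiplies both sides of the angle relation by the same
  squared norm. Angles may therefore be computed from representatives that are not unit
  vectors.\<close>

lemma hinner_angle:
  fixes v w :: "'a::involutive_div_algebra ^ 'n"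
  assumes "line_of v = line_of x" "line_of w = line_of y"
    and "hinner v v = of_real N" "hinner w w = of_real M"
    and "hinner x x = of_real N'" "hinner y y = of_real M'"
    and "N > 0" "M > 0" "N' > 0" "M' > 0" "(norm (hinner v w))\<^sup>2 = t * (N * M)"
  shows "(norm (hinner x y))\<^sup>2 = t * (N' * M')"
proof -
  obtain c where c: "x = rscale v c"
    using assms(1) by (metis line_of_eqD)
  obtain d where d: "y = rscale w d"
    using assms(2) by (metis line_of_eqD)
  have N': "(norm c)\<^sup>2 * N = N'"
    using arg_cong[OF assms(5), of norm] assms(3,7,9)
    by (simp add: c hinner_rscale norm_mult power2_eq_square mult_ac)
  have M': "(norm d)\<^sup>2 * M = M'"
    using arg_cong[OF assms(6), of norm] assms(4,8,10)
    by (simp add: d hinner_rscale norm_mult power2_eq_square mult_ac)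
  have "(norm (hinner x y))\<^sup>2 = (norm c)\<^sup>2 * (norm d)\<^sup>2 * (norm (hinner v w))\<^sup>2"
    by (simp add: c d hinner_rscale norm_mult power_mult_distrib)
  then show ?thesis
    unfolding assms(11) N'[symmetric] M'[symmetric] by (simp add: mult_ac)
qed

text \<open>Injectivity comes from the angle itself: if \<open>v\<close> and \<open>w\<close>
  spanned one line, \<open>v\<close> could be replaced by \<open>w\<close> in the angle relation,
  which would force \<open>t = 1\<close>.\<close>

lemma equiangular_line_of_image:
  fixes V :: "('a::involutive_div_algebra ^ 'n) set"
  assumes N: "\<And>v. v \<in> V \<Longrightarrow> hinner v v = of_real (N v)" "\<And>v. v \<in> V \<Longrightarrow> N v > 0"
    and angle: "\<And>v w. v \<in> V \<Longrightarrow> w \<in> V \<Longrightarrow> v \<noteq> w \<Longrightarrow> (norm (hinner v w))\<^sup>2 = t * (N v * N w)"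
    and "t \<noteq> 1"
  shows "equiangular t (line_of ` V)" "inj_on line_of V"
proof -
  have "is_line (line_of v)" if "v \<in> V" for v
  proof -
    have "v \<noteq> 0"
      using N[OF that] by (auto simp: hinner_def)
    then show ?thesis
      by (auto simp: is_line_def)
  qed
  moreover have "(norm (hinner x y))\<^sup>2 = t"
    if "v \<in> V" "w \<in> V" "line_of v \<noteq> line_of w" "hinner x x = 1" "hinner y y = 1"
      "line_of v = line_of x" "line_of w = line_of y" for v w x y
    using hinner_angle[of v x w y "N v" "N w" 1 1 t] that N angle[of v w] by auto
  ultimately show "equiangular t (line_of ` V)"
    unfolding equiangular_def by blast
  show "inj_on line_of V"
  proof (rule inj_onI, rule ccontr)
    fix v w
    assume vw: "v \<in> V" "w \<in> V" "line_of v = line_of w" "v \<noteq> w"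
    have "(norm (hinner w w))\<^sup>2 = t * (N w * N w)"
      using hinner_angle[of v w w w "N v" "N w" "N w" "N w" t] vw N angle[of v w] by auto
    then have "(1 - t) * (N w * N w) = 0"
      using N(1)[OF vw(2)] by (simp add: power2_eq_square algebra_simps)
    then show False
      using N(2)[OF vw(2)] \<open>t \<noteq> 1\<close> by simp
  qed
qed

lemma unitary_nonzero:
  assumes "A \<in> carrier unitary_group" "v \<noteq> 0"
  shows "A *v v \<noteq> (0 :: 'a::involutive_div_algebra ^ 'n)"
proof
  assume *: "A *v v = 0"
  have "v = (cadjoint A ** A) *v v"
    using assms(1) by (simp add: unitary_iff)
  also have "\<dots> = cadjoint A *v (A *v v)"
    by (simp add: matrix_vector_mul_assoc)
  finally show False
    using assms(2) by (simp add: *)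
qed

text \<open>The conjugate fixes \<open>g *v v\<close>, which is nonzero because \<open>g\<close> is
  unitary.\<close>

lemma reflection_conjugate:
  fixes A g :: "'a::involutive_div_algebra ^ 2 ^ 2"
  assumes "A \<in> carrier unitary_group" "g \<in> carrier unitary_group" "A \<noteq> mat 1" "v \<noteq> 0" "A *v v = v"
  shows "reflection (g ** A ** inv\<^bsub>unitary_group\<^esub> g)"
proof (rule reflectionI)
  show "g ** A ** inv\<^bsub>unitary_group\<^esub> g \<in> carrier unitary_group"
    using assms by simp
  show "g ** A ** inv\<^bsub>unitary_group\<^esub> g \<noteq> mat 1"
  proof
    assume "g ** A ** inv\<^bsub>unitary_group\<^esub> g = mat 1"
    then have "inv\<^bsub>unitary_group\<^esub> g ** (g ** A ** inv\<^bsub>unitary_group\<^esub> g) ** g = mat 1"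
      using assms by simp
    moreover have "inv\<^bsub>unitary_group\<^esub> g ** (g ** A ** inv\<^bsub>unitary_group\<^esub> g) ** g =
        (inv\<^bsub>unitary_group\<^esub> g ** g) ** A ** (inv\<^bsub>unitary_group\<^esub> g ** g)"
      by (simp only: matrix_mul_assoc)
    ultimately show False
      using assms by simp
  qed
  show "g *v v \<noteq> 0"
    using assms by (simp add: unitary_nonzero)
  have "(inv\<^bsub>unitary_group\<^esub> g ** g) *v v = v"
    using assms by simp
  then show "(g ** A ** inv\<^bsub>unitary_group\<^esub> g) *v (g *v v) = g *v v"
    using assms(5) by (simp flip: matrix_vector_mul_assoc)
qed

lemma inv_unitary_group:
  assumes "A \<in> carrier (unitary_group :: ('a::involutive_div_algebra ^ 2 ^ 2) monoid)"
  shows "inv\<^bsub>unitary_group\<^esub> A = cadjoint A"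
  using assms by (intro U.inv_equality) (simp_all add: unitary_iff cadjoint_right_inverse)

text \<open>The last hypothesis says that the slope of \<open>A *v v\<close> is z / a, cleared of
  denominators, so finding the image of a line becomes one identity between quaternions. That
  \<open>x\<close> is nonzero need not be assumed: otherwise the relation would make all of
  \<open>A *v v\<close> vanish.\<close>

lemma image_line_fst:
  fixes A :: "quat ^ 2 ^ 2" and z :: quat
  assumes "A \<in> carrier unitary_group" "v \<noteq> 0" "A *v v = vector [x, y]" "a \<noteq> 0"
    and "Quat a 0 0 0 * y = z * x"
  shows "(*v) A ` line_of v = line_of (vector [Quat a 0 0 0, z])"
proof -
  have a: "Quat a 0 0 0 = a *\<^sub>R 1"
    by (simp add: one_quat_def scaleR_quat_def)
  with assms(5) have "a *\<^sub>R y = z * x"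
    by simp
  from arg_cong[OF this, of "scaleR (1 / a)"] assms(4) have "y = z * ((1 / a) *\<^sub>R x)"
    by simp
  then have eq: "(vector [x, y] :: quat ^ 2) = rscale (vector [Quat a 0 0 0, z]) ((1 / a) *\<^sub>R x)"
    using assms(4) by (simp add: a rscale_vector2 vector2_eq_iff)
  moreover have "A *v v \<noteq> 0"
    using assms(1,2) by (rule unitary_nonzero)
  ultimately have "(1 / a) *\<^sub>R x \<noteq> 0"
    using assms(3) by (metis rscale_eq_0_iff)
  then show ?thesis
    unfolding image_line_of assms(3) eq by (rule line_of_rscale)
qed

lemma image_line_snd:
  fixes A :: "quat ^ 2 ^ 2" and z :: quat
  assumes "A \<in> carrier unitary_group" "v \<noteq> 0" "A *v v = vector [x, y]" "a \<noteq> 0"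
    and "Quat a 0 0 0 * x = z * y"
  shows "(*v) A ` line_of v = line_of (vector [z, Quat a 0 0 0])"
proof -
  have a: "Quat a 0 0 0 = a *\<^sub>R 1"
    by (simp add: one_quat_def scaleR_quat_def)
  with assms(5) have "a *\<^sub>R x = z * y"
    by simp
  from arg_cong[OF this, of "scaleR (1 / a)"] assms(4) have "x = z * ((1 / a) *\<^sub>R y)"
    by simp
  then have eq: "(vector [x, y] :: quat ^ 2) = rscale (vector [z, Quat a 0 0 0]) ((1 / a) *\<^sub>R y)"
    using assms(4) by (simp add: a rscale_vector2 vector2_eq_iff)
  moreover have "A *v v \<noteq> 0"
    using assms(1,2) by (rule unitary_nonzero)
  ultimately have "(1 / a) *\<^sub>R y \<noteq> 0"
    using assms(3) by (metis rscale_eq_0_iff)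
  then show ?thesis
    unfolding image_line_of assms(3) eq by (rule line_of_rscale)
qed

section \<open>Action of the generators on the six lines\<close>

lemma sqrt_simps:
  "sqrt 10 = sqrt 2 * sqrt 5"
  "sqrt 2 * (sqrt 2 * x) = 2 * x" "sqrt 3 * (sqrt 3 * x) = 3 * x" "sqrt 5 * (sqrt 5 * x) = 5 * x"
  "1 / sqrt 3 = sqrt 3 / 3" "y / sqrt 3 = y * sqrt 3 / 3"
  by (simp_all flip: real_sqrt_mult mult.assoc) (simp_all add: field_simps)

lemma b_unitary: "b1 \<in> carrier unitary_group" "b2 \<in> carrier unitary_group"
  "b3 \<in> carrier unitary_group" "b4 \<in> carrier unitary_group"
  unfolding unitary_iff b1_def b2_def b3_def b4_def cadjoint_mat2 mat2_mult mat_eq_mat2 mat2_eq_iff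
  by (simp_all add: quat_ring_defs sqrt_simps algebra_simps)

definition six_line :: "nat \<Rightarrow> (quat ^ 2) set" where
  "six_line i = line_of (six_vectors ! (i - 1))"

lemma six_line_simps:
  "six_line 1 = line_of (vector [Quat (sqrt 2 + sqrt 10) 0 0 0, Quat (sqrt 3) (- 1) 1 (sqrt 3)])"
  "six_line 2 = line_of (vector [Quat (sqrt 2 + sqrt 10) 0 0 0, Quat 0 2 (- 2) 0])"
  "six_line 3 = line_of (vector [Quat (sqrt 2 + sqrt 10) 0 0 0, Quat (- sqrt 3) (- 1) 1 (- sqrt 3)])"
  "six_line 4 = line_of (vector [Quat (- sqrt 3) (- 1) (- 1) (- sqrt 3), Quat (sqrt 2 + sqrt 10) 0 0 0])"
  "six_line 5 = line_of (vector [Quat 0 2 2 0, Quat (sqrt 2 + sqrt 10) 0 0 0])"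
  "six_line 6 = line_of (vector [Quat (sqrt 3) (- 1) (- 1) (sqrt 3), Quat (sqrt 2 + sqrt 10) 0 0 0])"
  by (simp_all add: six_line_def six_vectors_def Let_def numeral_eq_Suc)

lemma sqrt2_plus_sqrt10_nonzero: "sqrt 2 + sqrt 10 \<noteq> 0"
  by (metis add_pos_pos less_numeral_extra(3) real_sqrt_gt_0_iff zero_less_numeral)

lemma Quat_eq_0_iff: "Quat a b c d = 0 \<longleftrightarrow> a = 0 \<and> b = 0 \<and> c = 0 \<and> d = 0"
  by (auto simp: zero_quat_def)

lemma vector2_eq_0_iff: "(vector [x, y] :: 'a::zero ^ 2) = 0 \<longleftrightarrow> x = 0 \<and> y = 0"
  by (simp add: vec_eq_iff forall_2)

lemma b1_lines:
  "(*v) b1 ` six_line 1 = six_line 2" "(*v) b1 ` six_line 2 = six_line 3"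
  "(*v) b1 ` six_line 3 = six_line 1" "(*v) b1 ` six_line 4 = six_line 5"
  "(*v) b1 ` six_line 5 = six_line 6" "(*v) b1 ` six_line 6 = six_line 4"
  unfolding six_line_simps
  by - ((rule image_line_fst[OF b_unitary(1) _ _ sqrt2_plus_sqrt10_nonzero]
        image_line_snd[OF b_unitary(1) _ _ sqrt2_plus_sqrt10_nonzero],
      simp add: vector2_eq_0_iff Quat_eq_0_iff sqrt2_plus_sqrt10_nonzero,
      simp only: b1_def mat2_vector,
      simp add: quat_ring_defs sqrt_simps algebra_simps)+)

lemma b2_lines:
  "(*v) b2 ` six_line 1 = six_line 4" "(*v) b2 ` six_line 2 = six_line 2"
  "(*v) b2 ` six_line 3 = six_line 6" "(*v) b2 ` six_line 4 = six_line 1"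
  "(*v) b2 ` six_line 5 = six_line 5" "(*v) b2 ` six_line 6 = six_line 3"
  unfolding six_line_simps
  by - ((rule image_line_fst[OF b_unitary(2) _ _ sqrt2_plus_sqrt10_nonzero]
        image_line_snd[OF b_unitary(2) _ _ sqrt2_plus_sqrt10_nonzero],
      simp add: vector2_eq_0_iff Quat_eq_0_iff sqrt2_plus_sqrt10_nonzero,
      simp only: b2_def mat2_vector,
      simp add: quat_ring_defs sqrt_simps algebra_simps)+)

lemma b3_lines:
  "(*v) b3 ` six_line 1 = six_line 1" "(*v) b3 ` six_line 2 = six_line 3"
  "(*v) b3 ` six_line 3 = six_line 2" "(*v) b3 ` six_line 4 = six_line 5"
  "(*v) b3 ` six_line 5 = six_line 4" "(*v) b3 ` six_line 6 = six_line 6"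
  unfolding six_line_simps
  by - ((rule image_line_fst[OF b_unitary(3) _ _ sqrt2_plus_sqrt10_nonzero]
        image_line_snd[OF b_unitary(3) _ _ sqrt2_plus_sqrt10_nonzero],
      simp add: vector2_eq_0_iff Quat_eq_0_iff sqrt2_plus_sqrt10_nonzero,
      simp only: b3_def mat2_vector,
      simp add: quat_ring_defs sqrt_simps algebra_simps)+)

lemma b4_lines:
  "(*v) b4 ` six_line 1 = six_line 3" "(*v) b4 ` six_line 2 = six_line 2"
  "(*v) b4 ` six_line 3 = six_line 1" "(*v) b4 ` six_line 4 = six_line 6"
  "(*v) b4 ` six_line 5 = six_line 5" "(*v) b4 ` six_line 6 = six_line 4"
  unfolding six_line_simps
  by - ((rule image_line_fst[OF b_unitary(4) _ _ sqrt2_plus_sqrt10_nonzero]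
        image_line_snd[OF b_unitary(4) _ _ sqrt2_plus_sqrt10_nonzero],
      simp add: vector2_eq_0_iff Quat_eq_0_iff sqrt2_plus_sqrt10_nonzero,
      simp only: b4_def mat2_vector,
      simp add: quat_ring_defs sqrt_simps algebra_simps)+)

lemma six_lines_eq: "six_lines = six_line ` {1..6}"
  by (simp add: six_lines_def six_line_def six_vectors_def Let_def numeral_eq_Suc
      atLeastAtMostSuc_conv insert_commute)

section \<open>Equiangularity of the six lines\<close>

lemma distinct_six_vectors: "distinct six_vectors"
  by (simp add: six_vectors_def Let_def vector2_eq_iff)

lemma norm_six_vectors: "v \<in> set six_vectors \<Longrightarrow> norm v = sqrt (20 + 4 * sqrt 5)"
  unfolding norm_vec_def L2_set_def sum_2 norm_quat_power2
  by (auto simp: six_vectors_def Let_def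
      sqrt_simps power2_eq_square algebra_simps)

text \<open>In each vector one entry is sqrt 2 + sqrt 10, of square 12 + 4 sqrt 5, and the other has
  squared norm 8.\<close>

lemma hinner_six_vectors_self:
  "v \<in> set six_vectors \<Longrightarrow> hinner v v = of_real (20 + 4 * sqrt 5)"
  by (auto simp: six_vectors_def Let_def hinner_vector2 of_real_def quat_ring_defs
      sqrt_simps algebra_simps)

lemma hinner_six_vectors:
  "v \<in> set six_vectors \<Longrightarrow> w \<in> set six_vectors \<Longrightarrow> v \<noteq> w \<Longrightarrow>
     (norm (hinner v w))\<^sup>2 = 2 / 5 * ((20 + 4 * sqrt 5) * (20 + 4 * sqrt 5))"
  unfolding six_vectors_def Let_def list.set insert_iff empty_iff
  by (elim disjE FalseE; hypsubst; (erule notE, rule refl)?;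
      simp add: hinner_vector2 quat_ring_defs norm_quat_power2 sqrt_simps;
      (simp add: power2_eq_square sqrt_simps algebra_simps)?)

lemma equiangular_six_lines: "equiangular (2 / 5) six_lines"
  and inj_on_line_of_six_vectors: "inj_on line_of (set six_vectors)"
  using equiangular_line_of_image[of "set six_vectors" "\<lambda>_. 20 + 4 * sqrt 5" "2 / 5"]
  by (simp_all add: six_lines_def hinner_six_vectors_self hinner_six_vectors add_pos_nonneg)

lemma inj_on_six_line: "inj_on six_line {1..6}"
proof (rule inj_onI)
  fix i j :: nat
  assume ij: "i \<in> {1..6}" "j \<in> {1..6}" "six_line i = six_line j"
  have "length six_vectors = 6"
    by (simp add: six_vectors_def Let_def)
  with ij have "six_vectors ! (i - 1) = six_vectors ! (j - 1)"
    by (intro inj_onD[OF inj_on_line_of_six_vectors]) (auto simp: six_line_def)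
  with ij \<open>length six_vectors = 6\<close> show "i = j"
    by (auto simp: nth_eq_iff_index_eq[OF distinct_six_vectors])
qed

lemma card_six_lines: "card six_lines = 6"
  unfolding six_lines_eq card_image[OF inj_on_six_line] by simp

section \<open>The action on the six lines\<close>

lemma fixed_line:
  assumes "(*v) A ` line_of v = line_of v"
  obtains t where "A *v v = rscale v t"
proof -
  have "A *v v \<in> line_of v"
    using assms line_of_self by (metis image_line_of)
  then show ?thesis
    using that by (auto simp: line_of_def)
qed

text \<open>Eliminating the eigenvalue \<open>t\<close> from the two rows leaves the fixed-point
  equation r + s m = m p + m q m of the Moebius action on the slope m = z / a, multiplied by the
  square of \<open>a\<close>.\<close>

lemma fixed_line_fst:
  fixes z :: quat
  assumes "(*v) (mat2 p q r s) ` line_of (vector [Quat a 0 0 0, z]) = line_of (vector [Quat a 0 0 0, z])"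
  shows "a\<^sup>2 *\<^sub>R r + a *\<^sub>R (s * z) = a *\<^sub>R (z * p) + z * q * z"
proof -
  have a: "Quat a 0 0 0 = a *\<^sub>R 1"
    by (simp add: one_quat_def scaleR_quat_def)
  obtain t where "mat2 p q r s *v vector [a *\<^sub>R 1, z] = rscale (vector [a *\<^sub>R 1, z]) t"
    using fixed_line[OF assms] unfolding a by blast
  then have t: "a *\<^sub>R p + q * z = a *\<^sub>R t" "a *\<^sub>R r + s * z = z * t"
    by (simp_all add: mat2_vector rscale_vector2 vector2_eq_iff)
  have "a\<^sup>2 *\<^sub>R r + a *\<^sub>R (s * z) = a *\<^sub>R (a *\<^sub>R r + s * z)"
    by (simp add: power2_eq_square scaleR_add_right)
  also have "\<dots> = z * (a *\<^sub>R t)"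
    by (simp add: t(2))
  also have "\<dots> = a *\<^sub>R (z * p) + z * q * z"
    by (simp add: distrib_left mult.assoc flip: t(1))
  finally show ?thesis .
qed

lemma fixed_line_snd:
  fixes z :: quat
  assumes "(*v) (mat2 p q r s) ` line_of (vector [z, Quat a 0 0 0]) = line_of (vector [z, Quat a 0 0 0])"
  shows "a\<^sup>2 *\<^sub>R q + a *\<^sub>R (p * z) = a *\<^sub>R (z * s) + z * r * z"
proof -
  have a: "Quat a 0 0 0 = a *\<^sub>R 1"
    by (simp add: one_quat_def scaleR_quat_def)
  obtain t where "mat2 p q r s *v vector [z, a *\<^sub>R 1] = rscale (vector [z, a *\<^sub>R 1]) t"
    using fixed_line[OF assms] unfolding a by blast
  then have t: "p * z + a *\<^sub>R q = z * t" "r * z + a *\<^sub>R s = a *\<^sub>R t"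
    by (simp_all add: mat2_vector rscale_vector2 vector2_eq_iff)
  have "a\<^sup>2 *\<^sub>R q + a *\<^sub>R (p * z) = a *\<^sub>R (p * z + a *\<^sub>R q)"
    by (simp add: power2_eq_square scaleR_add_right)
  also have "\<dots> = z * (a *\<^sub>R t)"
    by (simp add: t(1))
  also have "\<dots> = a *\<^sub>R (z * s) + z * r * z"
    by (simp add: distrib_left mult.assoc flip: t(2))
  finally show ?thesis .
qed

text \<open>Added over three slopes with sum zero, the terms linear in \<open>z\<close> cancel, and
  three times the square of \<open>a\<close> times \<open>r\<close> equals the sum of the products
  \<open>z * q * z\<close>. The triangle inequality then compares the two off-diagonal
  entries.\<close>

lemma norm_sandwich_sum:
  fixes p q r s :: quat
  assumes "\<And>z. z \<in> {z1, z2, z3} \<Longrightarrow> a\<^sup>2 *\<^sub>R r + a *\<^sub>R (s * z) = a *\<^sub>R (z * p) + z * q * z"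
    and "z1 + z2 + z3 = 0" and "\<And>z. z \<in> {z1, z2, z3} \<Longrightarrow> norm z * norm z = b"
  shows "a\<^sup>2 * norm r \<le> b * norm q"
proof -
  have "(3 * a\<^sup>2) *\<^sub>R r + a *\<^sub>R (s * (z1 + z2 + z3)) =
      (a\<^sup>2 *\<^sub>R r + a *\<^sub>R (s * z1)) + (a\<^sup>2 *\<^sub>R r + a *\<^sub>R (s * z2)) + (a\<^sup>2 *\<^sub>R r + a *\<^sub>R (s * z3))"
  proof -
    have "(3 * a\<^sup>2) *\<^sub>R r = a\<^sup>2 *\<^sub>R r + a\<^sup>2 *\<^sub>R r + a\<^sup>2 *\<^sub>R r"
      by (simp flip: scaleR_add_left)
    then show ?thesis
      by (simp add: distrib_left scaleR_add_right)
  qed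
  also have "\<dots> = (a *\<^sub>R (z1 * p) + z1 * q * z1) + (a *\<^sub>R (z2 * p) + z2 * q * z2) + (a *\<^sub>R (z3 * p) + z3 * q * z3)"
    by (simp only: assms(1) insert_iff simp_thms)
  also have "\<dots> = a *\<^sub>R ((z1 + z2 + z3) * p) + (z1 * q * z1 + z2 * q * z2 + z3 * q * z3)"
    by (simp add: distrib_right scaleR_add_right)
  finally have "(3 * a\<^sup>2) *\<^sub>R r = z1 * q * z1 + z2 * q * z2 + z3 * q * z3"
    by (simp add: assms(2))
  then have "norm ((3 * a\<^sup>2) *\<^sub>R r) \<le> norm (z1 * q * z1) + norm (z2 * q * z2) + norm (z3 * q * z3)"
    by (simp only:) (rule order_trans[OF norm_triangle_ineq add_right_mono[OF norm_triangle_ineq]])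
  also have "\<dots> = (norm z1 * norm z1 + norm z2 * norm z2 + norm z3 * norm z3) * norm q"
    by (simp add: norm_mult algebra_simps)
  also have "\<dots> = 3 * (b * norm q)"
    by (simp add: assms(3))
  finally show ?thesis
    by simp
qed

text \<open>A unitary matrix fixing all six lines is diagonal because \<open>8 < (\<surd>2 + \<surd>10)\<^sup>2\<close>, and then it is a
  real scalar.\<close>

lemma fixes_six_lines:
  assumes "A \<in> carrier unitary_group" "\<And>i. i \<in> {1..6} \<Longrightarrow> (*v) A ` six_line i = six_line i"
  shows "A = mat 1 \<or> A = - mat 1"
proof -
  obtain p q r s where A: "A = mat2 p q r s"
    by (rule mat2_cases)
  define a where "a = sqrt 2 + sqrt 10"
  have a2: "a\<^sup>2 = 12 + 4 * sqrt 5" and a0: "a \<noteq> 0"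
    using sqrt2_plus_sqrt10_nonzero by (simp_all add: a_def power2_eq_square sqrt_simps algebra_simps)
  define z where "z = (\<lambda>i :: nat. [Quat (sqrt 3) (- 1) 1 (sqrt 3), Quat 0 2 (- 2) 0,
    Quat (- sqrt 3) (- 1) 1 (- sqrt 3)] ! i)"
  define y where "y = (\<lambda>i :: nat. [Quat (- sqrt 3) (- 1) (- 1) (- sqrt 3), Quat 0 2 2 0,
    Quat (sqrt 3) (- 1) (- 1) (sqrt 3)] ! i)"
  \<comment> \<open>\<open>z 1\<close> and \<open>z 2\<close> are \<open>z 0\<close> multiplied on
    the left by \<omega> and its square; \<open>y 1\<close> and \<open>y 2\<close> are
    \<open>y 0\<close> multiplied on the right by the conjugates of these. Each sum contains the
    factor 1 + \<omega> + \<omega>^2 = 0.\<close>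
  have zy: "z 0 + z 1 + z 2 = 0" "y 0 + y 1 + y 2 = 0"
    by (simp_all add: z_def y_def quat_ring_defs)
  have norm: "norm x * norm x = 8" if "x \<in> {z 0, z 1, z 2} \<union> {y 0, y 1, y 2}" for x
    using that unfolding power2_eq_square[symmetric] norm_quat_power2 by (auto simp: z_def y_def)
  have fixed: "(*v) A ` six_line 1 = six_line 1" "(*v) A ` six_line 2 = six_line 2"
    "(*v) A ` six_line 3 = six_line 3" "(*v) A ` six_line 4 = six_line 4"
    "(*v) A ` six_line 5 = six_line 5" "(*v) A ` six_line 6 = six_line 6"
    by - (rule assms(2), simp)+
  have eqz: "a\<^sup>2 *\<^sub>R r + a *\<^sub>R (s * x) = a *\<^sub>R (x * p) + x * q * x" if "x \<in> {z 0, z 1, z 2}" for x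
    using that fixed(1-3)[unfolded A six_line_simps, THEN fixed_line_fst]
    by (auto simp: z_def a_def)
  have eqy: "a\<^sup>2 *\<^sub>R q + a *\<^sub>R (p * x) = a *\<^sub>R (x * s) + x * r * x" if "x \<in> {y 0, y 1, y 2}" for x
    using that fixed(4-6)[unfolded A six_line_simps, THEN fixed_line_snd]
    by (auto simp: y_def a_def)
  have "a\<^sup>2 * norm r \<le> 8 * norm q" "a\<^sup>2 * norm q \<le> 8 * norm r"
    using norm_sandwich_sum[OF eqz zy(1)] norm_sandwich_sum[OF eqy zy(2)] norm by blast+
  moreover have *: "12 * norm x \<le> a\<^sup>2 * norm x" for x :: quat
    unfolding a2 by (intro mult_right_mono) auto
  ultimately have "12 * norm r \<le> 8 * norm q" "12 * norm q \<le> 8 * norm r"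
    using *[of r] *[of q] by linarith+
  then have "norm r \<le> 0" "norm q \<le> 0"
    using norm_ge_zero[of q] norm_ge_zero[of r] by linarith+
  then have 0: "r = 0" "q = 0"
    by simp_all
  have sz: "s * x = x * p" if "x \<in> {z 0, z 1, z 2}" for x
    using eqz[OF that] a0 by (simp add: 0)
  have py: "p * x = x * s" if "x \<in> {y 0, y 1, y 2}" for x
    using eqy[OF that] a0 by (simp add: 0)
  \<comment> \<open>The combination isolates 1 + k. The three relations then say that
    \<open>s\<close> is the conjugate of \<open>p\<close> by 1 + k and by i - j, while
    \<open>p\<close> is the conjugate of \<open>s\<close> by i + j. The corresponding rotations of
    imaginary parts (a quarter turn and two half turns) are compatible only when these parts vanish,
    so \<open>p\<close> and \<open>s\<close> are the same real number.\<close>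
  have "Quat 1 0 0 1 = (1 / sqrt 3) *\<^sub>R (z 0 + (1 / 2) *\<^sub>R z 1)"
    by (simp add: z_def quat_ring_defs)
  then have s1: "s * Quat 1 0 0 1 = Quat 1 0 0 1 * p"
    using sz[of "z 0"] sz[of "z 1"] by (simp add: distrib_left distrib_right)
  have s2: "s * Quat 0 2 (- 2) 0 = Quat 0 2 (- 2) 0 * p"
    using sz[of "z 1"] by (simp add: z_def)
  have p1: "p * Quat 0 2 2 0 = Quat 0 2 2 0 * s"
    using py[of "y 1"] by (simp add: y_def)
  obtain x where x: "p = x *\<^sub>R 1" "s = x *\<^sub>R 1"
  proof
    show "p = qre p *\<^sub>R 1" "s = qre p *\<^sub>R 1"
      using s1 s2 p1 by (simp_all add: quat_eq_iff quat_ring_defs)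
  qed
  have "conjugate p * p + conjugate r * r = 1"
    using assms(1) by (simp add: unitary_iff A cadjoint_mat2 mat2_mult mat_eq_mat2 mat2_eq_iff)
  then have "x * x = 1"
    by (simp add: 0 x quat_ring_defs)
  then have "x = 1 \<or> x = - 1"
    by (simp add: square_eq_1_iff)
  then show ?thesis
    by (auto simp: A 0 x mat_eq_mat2 uminus_mat2)
qed

text \<open>\<open>perm_list\<close> turns one-line notation into a permutation.\<close>

definition perm_list :: "nat list \<Rightarrow> nat \<Rightarrow> nat" where
  "perm_list xs i = (if 1 \<le> i \<and> i \<le> length xs then xs ! (i - 1) else i)"

text \<open>This reduces products of permutations to evaluation on lists. The length condition
  ensures that a point beyond \<open>ys\<close> is fixed by both factors.\<close>

lemma perm_list_comp:
  assumes "length xs \<le> length ys"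
  shows "perm_list xs \<circ> perm_list ys = perm_list (map (perm_list xs) ys)"
  using assms by (auto simp: perm_list_def fun_eq_iff)

lemma inj_on_perm_list: "inj_on perm_list {xs. length xs = n}"
proof (rule inj_onI)
  fix xs ys :: "nat list"
  assume *: "xs \<in> {xs. length xs = n}" "ys \<in> {xs. length xs = n}" "perm_list xs = perm_list ys"
  then have "xs ! i = ys ! i" if "i < n" for i
    using that *(1,2) fun_cong[OF *(3), of "Suc i"] unfolding perm_list_def by simp
  with * show "xs = ys"
    by (simp add: list_eq_iff_nth_eq)
qed

lemma perm_list_id: "perm_list [1, 2, 3, 4, 5, 6] = id"
proof
  fix i :: nat
  consider "i = 0" | "i \<in> {1, 2, 3, 4, 5, 6}" | "i > 6"
    by force
  then show "perm_list [1, 2, 3, 4, 5, 6] i = id i"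
    by cases (auto simp: perm_list_def)
qed

lemma transpose_in_alt_group:
  assumes "{a, b, c, d} \<subseteq> {1..n}" "a \<noteq> b" "c \<noteq> d"
  shows "Transposition.transpose a b \<circ> Transposition.transpose c d \<in> carrier (alt_group n)"
  using assms
  by (auto simp: alt_group_carrier evenperm_comp evenperm_swap permutation_swap_id
      intro!: permutes_compose permutes_swap_id)

text \<open>Each right-hand side has an even number of transpositions, which is where the evenness
  of the four generators comes from.\<close>

lemma perm_list_transpose:
  "perm_list [2, 3, 1, 5, 6, 4] = (Transposition.transpose 1 2 \<circ> Transposition.transpose 2 3) \<circ> (Transposition.transpose 4 5 \<circ> Transposition.transpose 5 6)"
  "perm_list [4, 2, 6, 1, 5, 3] = Transposition.transpose 1 4 \<circ> Transposition.transpose 3 6"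
  "perm_list [1, 3, 2, 5, 4, 6] = Transposition.transpose 2 3 \<circ> Transposition.transpose 4 5"
  "perm_list [3, 2, 1, 6, 5, 4] = Transposition.transpose 1 3 \<circ> Transposition.transpose 4 6"
proof -
  have *: "f = g" if "f 0 = g 0" "\<And>i. i \<in> {1, 2, 3, 4, 5, 6} \<Longrightarrow> f i = g i" "\<And>i. i > 6 \<Longrightarrow> f i = g i"
    for f g :: "nat \<Rightarrow> nat"
  proof
    fix i :: nat
    have "i = 0 \<or> i \<in> {1, 2, 3, 4, 5, 6} \<or> i > 6"
      by force
    with that show "f i = g i"
      by auto
  qed
  show "perm_list [2, 3, 1, 5, 6, 4] = (Transposition.transpose 1 2 \<circ> Transposition.transpose 2 3) \<circ> (Transposition.transpose 4 5 \<circ> Transposition.transpose 5 6)"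
  "perm_list [4, 2, 6, 1, 5, 3] = Transposition.transpose 1 4 \<circ> Transposition.transpose 3 6"
  "perm_list [1, 3, 2, 5, 4, 6] = Transposition.transpose 2 3 \<circ> Transposition.transpose 4 5"
  "perm_list [3, 2, 1, 6, 5, 4] = Transposition.transpose 1 3 \<circ> Transposition.transpose 4 6"
    by (rule *; auto simp: perm_list_def Transposition.transpose_def)+
qed

section \<open>The permutation attached to a matrix\<close>

interpretation alt6: group "alt_group 6"
  rewrites "mult (alt_group 6) = (\<circ>)" and "one (alt_group 6) = id"
  by (simp_all add: alt_group_is_group alt_group_mult alt_group_one)

text \<open>Kept as a relation because existence of the permutation is proved by induction over the
  generated group; evenness is bundled in so that the same induction carries it along.\<close>

definition acts :: "quat ^ 2 ^ 2 \<Rightarrow> (nat \<Rightarrow> nat) \<Rightarrow> bool" where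
  "acts A p \<longleftrightarrow> p \<in> carrier (alt_group 6) \<and> (\<forall>i\<in>{1..6}. (*v) A ` six_line i = six_line (p i))"

lemma alt_group_permutes: "p \<in> carrier (alt_group n) \<Longrightarrow> p permutes {1..n}"
  by (simp add: alt_group_carrier)

lemma acts_permutes: "acts A p \<Longrightarrow> p permutes {1..6}"
  unfolding acts_def by (blast intro: alt_group_permutes)

lemma acts_in: "acts A p \<Longrightarrow> i \<in> {1..6} \<Longrightarrow> p i \<in> {1..6}"
  using permutes_in_image[OF acts_permutes] by blast

lemma acts_unique:
  assumes "acts A p" "acts A q"
  shows "p = q"
proof
  fix i
  show "p i = q i"
  proof (cases "i \<in> {1..6}")
    case True
    with assms have "six_line (p i) = six_line (q i)"
      by (auto simp: acts_def)
    then show ?thesis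
      using True assms acts_in by (auto dest!: inj_onD[OF inj_on_six_line])
  next
    case False
    then show ?thesis
      using permutes_not_in[OF acts_permutes[OF assms(1)]] permutes_not_in[OF acts_permutes[OF assms(2)]]
      by simp
  qed
qed

lemma acts_one: "acts (mat 1) id"
  by (auto simp: acts_def)

lemma image_matrix_mult: "(*v) (A ** B) ` L = (*v) A ` (*v) B ` L"
  by (simp add: image_image matrix_vector_mul_assoc)

lemma acts_mult:
  assumes "acts A p" "acts B q"
  shows "acts (A ** B) (p \<circ> q)"
proof -
  have "q i \<in> {1..6}" if "i \<in> {1..6}" for i
    using that assms(2) by (rule acts_in[rotated])
  with assms show ?thesis
    by (auto simp: acts_def image_matrix_mult)
qed

lemma acts_inv:
  assumes "acts A p" "A \<in> carrier unitary_group"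
  shows "acts (inv\<^bsub>unitary_group\<^esub> A) (inv' p)"
proof -
  have p: "p \<in> carrier (alt_group 6)"
    using assms(1) by (simp add: acts_def)
  have "(*v) (inv\<^bsub>unitary_group\<^esub> A) ` six_line i = six_line (inv' p i)" if "i \<in> {1..6}" for i
  proof -
    have "inv' p i \<in> {1..6}"
      using that permutes_in_image[OF permutes_inv[OF alt_group_permutes[OF p]]] by blast
    then have "(*v) A ` six_line (inv' p i) = six_line i"
      using assms(1) permutes_inverses(1)[OF alt_group_permutes[OF p]] by (simp add: acts_def)
    then have "(*v) (inv\<^bsub>unitary_group\<^esub> A) ` six_line i =
        (*v) (inv\<^bsub>unitary_group\<^esub> A ** A) ` six_line (inv' p i)"
      by (simp add: image_matrix_mult)
    also have "\<dots> = six_line (inv' p i)"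
      using assms(2) by (simp add: image_def)
    finally show ?thesis .
  qed
  then show ?thesis
    using alt_group_inv_closed[OF p] by (simp add: acts_def)
qed

lemma atLeastAtMost_1_6: "{1..6 :: nat} = {1, 2, 3, 4, 5, 6}"
  by auto

lemma perm_list_in_alt_group:
  "perm_list [2, 3, 1, 5, 6, 4] \<in> carrier (alt_group 6)"
  "perm_list [4, 2, 6, 1, 5, 3] \<in> carrier (alt_group 6)"
  "perm_list [1, 3, 2, 5, 4, 6] \<in> carrier (alt_group 6)"
  "perm_list [3, 2, 1, 6, 5, 4] \<in> carrier (alt_group 6)"
  unfolding perm_list_transpose
  by (intro alt6.m_closed transpose_in_alt_group; simp)+

lemma acts_b1: "acts b1 (perm_list [2, 3, 1, 5, 6, 4])"
  and acts_b2: "acts b2 (perm_list [4, 2, 6, 1, 5, 3])"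
  and acts_b3: "acts b3 (perm_list [1, 3, 2, 5, 4, 6])"
  and acts_b4: "acts b4 (perm_list [3, 2, 1, 6, 5, 4])"
  unfolding acts_def atLeastAtMost_1_6
  using perm_list_in_alt_group b1_lines b2_lines b3_lines b4_lines
  by (simp_all add: perm_list_def)

lemma acts_uminus_one: "acts (- mat 1) id"
proof -
  have "- mat 1 *v v = rscale v (- 1)" for v :: "quat ^ 2"
    by (simp add: matrix_vector_mult_def mat_def rscale_def vec_eq_iff forall_2 sum_2)
  then have "(*v) (- mat 1) ` line_of v = line_of v" for v :: "quat ^ 2"
    unfolding image_line_of by (simp add: line_of_rscale)
  then show ?thesis
    by (simp add: acts_def six_line_def)
qed

definition line_perm :: "quat ^ 2 ^ 2 \<Rightarrow> nat \<Rightarrow> nat" where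
  "line_perm A = (THE p. acts A p)"

lemma line_perm_eqI: "acts A p \<Longrightarrow> line_perm A = p"
  unfolding line_perm_def using acts_unique by blast

lemma acts_generated:
  assumes "S \<subseteq> {b1, b2, b3, b4}" "A \<in> carrier (subgroup_generated unitary_group S)"
  shows "acts A (line_perm A)"
proof -
  have "A \<in> carrier unitary_group \<and> (\<exists>p. acts A p)"
    using assms(2) unfolding carrier_subgroup_generated
  proof (induction A rule: generate.induct)
    case one
    show ?case
      using acts_one by (auto simp: U.one_closed)
  next
    case (incl h)
    with assms(1) show ?case
      using acts_b1 acts_b2 acts_b3 acts_b4 by blast
  next
    case (inv h)
    moreover have "\<exists>p. acts h p"
      using inv assms(1) acts_b1 acts_b2 acts_b3 acts_b4 by blast
    ultimately show ?case
      using acts_inv by (auto simp: U.inv_closed)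
  next
    case (eng h1 h2)
    then show ?case
      unfolding mult_unitary_group by (blast intro: acts_mult U.m_closed)
  qed
  then show ?thesis
    using line_perm_eqI by blast
qed

lemma group_hom_line_perm:
  assumes "S \<subseteq> {b1, b2, b3, b4}"
  shows "group_hom (subgroup_generated unitary_group S) (alt_group 6) line_perm"
proof (rule group_hom.intro[OF U.group_subgroup_generated alt_group_is_group], unfold_locales)
  show "line_perm \<in> hom (subgroup_generated unitary_group S) (alt_group 6)"
    using acts_generated[OF assms] acts_mult
    by (auto simp: hom_def acts_def alt_group_mult intro!: line_perm_eqI)
qed

text \<open>Lagrange's theorem for the kernel, whose cosets are counted by the first isomorphism
  theorem once the codomain is cut down to the image.\<close>

lemma (in group_hom) order_eq_card_kernel_image:
  "order G = card (kernel G H h) * card (h ` carrier G)"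
proof -
  let ?I = "H\<lparr>carrier := h ` carrier G\<rparr>"
  interpret I: group_hom G ?I h
    by (intro group_hom.intro group_hom_axioms.intro G.is_group H.subgroup_imp_group img_is_subgroup)
      (auto simp: hom_def)
  have "h \<in> epi G ?I"
    using I.homh by (simp add: epi_def)
  have "(G Mod (kernel G ?I h)) \<cong> ?I"
    by (rule I.FactGroup_iso) simp
  then have "card (rcosets\<^bsub>G\<^esub> (kernel G ?I h)) = card (h ` carrier G)"
    using iso_same_card by (fastforce simp: FactGroup_def)
  then show ?thesis
    using G.lagrange[OF I.subgroup_kernel] by (simp add: kernel_def mult.commute)
qed

lemmas perm_list_eval = perm_list_def numeral_eq_Suc

section \<open>The groups \<open>H720\<close> and \<open>H24\<close> and the kernel of the
  action\<close>

lemma generators_in: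
  fixes A :: "'a::involutive_div_algebra ^ 2 ^ 2"
  assumes "A \<in> S" "S \<subseteq> carrier unitary_group"
  shows "A \<in> carrier (subgroup_generated unitary_group S)"
  using U.subgroup_generated_subset_carrier_subset[OF assms(2)] assms(1) by blast

lemma b_in_H720: "b1 \<in> carrier H720" "b2 \<in> carrier H720" "b3 \<in> carrier H720" "b4 \<in> carrier H720"
  and b_in_H24: "b1 \<in> carrier H24" "b2 \<in> carrier H24"
  unfolding H720_def H24_def using b_unitary by (auto intro!: generators_in)

lemma group_H720: "group H720" and group_H24: "group H24"
  unfolding H720_def H24_def by (rule U.group_subgroup_generated)+

lemma mult_H [simp]: "mult H720 = (**)" "one H720 = mat 1" "mult H24 = (**)" "one H24 = mat 1"
  by (simp_all add: H720_def H24_def)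

interpretation H720: group H720
  rewrites "mult H720 = (**)" and "one H720 = mat 1"
  by (simp_all add: group_H720)

interpretation H24: group H24
  rewrites "mult H24 = (**)" and "one H24 = mat 1"
  by (simp_all add: group_H24)

lemma H720_unitary: "A \<in> carrier H720 \<Longrightarrow> A \<in> carrier unitary_group"
  unfolding H720_def using U.carrier_subgroup_generated_subset by blast

lemma H24_subset_H720: "carrier H24 \<subseteq> carrier H720"
  unfolding H24_def H720_def carrier_subgroup_generated by (intro U.mono_generate) auto

lemma H24_subgroup: "subgroup (carrier H24) H720"
  using H24_subset_H720 U.subgroup_subgroup_generated
  unfolding H24_def H720_def U.subgroup_subgroup_generated_iff by blast

lemma H720_hom: "group_hom H720 (alt_group 6) line_perm"
  unfolding H720_def by (rule group_hom_line_perm) simp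

lemma H24_hom: "group_hom H24 (alt_group 6) line_perm"
  unfolding H24_def by (rule group_hom_line_perm) simp

lemma acts_H720: "A \<in> carrier H720 \<Longrightarrow> acts A (line_perm A)"
  unfolding H720_def by (rule acts_generated) simp_all

lemma line_perm_b:
  "line_perm b1 = perm_list [2, 3, 1, 5, 6, 4]" "line_perm b2 = perm_list [4, 2, 6, 1, 5, 3]"
  "line_perm b3 = perm_list [1, 3, 2, 5, 4, 6]" "line_perm b4 = perm_list [3, 2, 1, 6, 5, 4]"
  by (intro line_perm_eqI acts_b1 acts_b2 acts_b3 acts_b4)+

lemma b2_square: "b2 ** b2 = - mat 1"
  by (simp add: b2_def mat2_mult mat_eq_mat2 uminus_mat2 mat2_eq_iff quat_ring_defs
      sqrt_simps algebra_simps)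

lemma uminus_one_in_H24: "- mat 1 \<in> carrier H24"
  using H24.m_closed[OF b_in_H24(2) b_in_H24(2)] by (simp add: b2_square)

lemma kernel_line_perm: "kernel H720 (alt_group 6) line_perm = {mat 1, - mat 1}"
proof
  show "kernel H720 (alt_group 6) line_perm \<subseteq> {mat 1, - mat 1}"
  proof
    fix A
    assume "A \<in> kernel H720 (alt_group 6) line_perm"
    then have A: "A \<in> carrier H720" "line_perm A = id"
      by (simp_all add: kernel_def alt_group_one)
    then have "(*v) A ` six_line i = six_line i" if "i \<in> {1..6}" for i
      using acts_H720[OF A(1)] that by (auto simp: acts_def)
    with A show "A \<in> {mat 1, - mat 1}"
      using fixes_six_lines[OF H720_unitary] by blast
  qed
  show "{mat 1, - mat 1} \<subseteq> kernel H720 (alt_group 6) line_perm"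
    using uminus_one_in_H24 H24_subset_H720 H720.one_closed line_perm_eqI[OF acts_one]
      line_perm_eqI[OF acts_uminus_one]
    by (auto simp: kernel_def alt_group_one)
qed

lemma kernel_line_perm_H24: "kernel H24 (alt_group 6) line_perm = {mat 1, - mat 1}"
proof -
  have "kernel H24 (alt_group 6) line_perm = kernel H720 (alt_group 6) line_perm \<inter> carrier H24"
    using H24_subset_H720 by (auto simp: kernel_def)
  then show ?thesis
    using kernel_line_perm uminus_one_in_H24 H24.one_closed by auto
qed

lemma card_pm_one: "card {mat 1, - mat 1 :: quat ^ 2 ^ 2} = 2"
proof -
  have "mat 1 \<noteq> (- mat 1 :: quat ^ 2 ^ 2)"
    by (simp add: mat_eq_mat2 uminus_mat2 mat2_eq_iff quat_ring_defs)
  then show ?thesis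
    by simp
qed

section \<open>The image of \<open>H24\<close>: a copy of A_4, transitive on six points\<close>

definition H24_perms :: "nat list list" where
  "H24_perms =
  [[1, 2, 3, 4, 5, 6],
   [2, 3, 1, 5, 6, 4],
   [4, 2, 6, 1, 5, 3],
   [3, 1, 2, 6, 4, 5],
   [2, 6, 4, 5, 3, 1],
   [5, 3, 4, 2, 6, 1],
   [6, 4, 2, 3, 1, 5],
   [3, 4, 5, 6, 1, 2],
   [6, 1, 5, 3, 4, 2],
   [5, 6, 1, 2, 3, 4],
   [4, 5, 3, 1, 2, 6],
   [1, 5, 6, 4, 2, 3]]"

lemma H24_perms_closed:
  assumes "xs \<in> set H24_perms"
  shows "perm_list [2, 3, 1, 5, 6, 4] \<circ> perm_list xs \<in> perm_list ` set H24_perms"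
    "perm_list [4, 2, 6, 1, 5, 3] \<circ> perm_list xs \<in> perm_list ` set H24_perms"
proof -
  have "\<forall>xs\<in>set H24_perms. length xs = 6 \<and> map (perm_list [2, 3, 1, 5, 6, 4]) xs \<in> set H24_perms \<and>
      map (perm_list [4, 2, 6, 1, 5, 3]) xs \<in> set H24_perms"
    by (simp add: H24_perms_def perm_list_eval)
  with assms show "perm_list [2, 3, 1, 5, 6, 4] \<circ> perm_list xs \<in> perm_list ` set H24_perms"
    "perm_list [4, 2, 6, 1, 5, 3] \<circ> perm_list xs \<in> perm_list ` set H24_perms"
    by (simp_all add: perm_list_comp)
qed

text \<open>The list is stable under left multiplication by both generators. Since these have orders
  3 and 2, their inverses are positive powers, so the list is stable under the whole generated
  group; applying that to \<open>id\<close> gives one inclusion.\<close>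

lemma generate_H24_perms:
  "generate (alt_group 6) {perm_list [2, 3, 1, 5, 6, 4], perm_list [4, 2, 6, 1, 5, 3]} =
     perm_list ` set H24_perms"
  (is "?G = ?L")
proof
  let ?p1 = "perm_list [2, 3, 1, 5, 6, 4]" and ?p2 = "perm_list [4, 2, 6, 1, 5, 3]"
  have id: "id \<in> ?L"
    using perm_list_id by (force simp: H24_perms_def)
  have p1: "?p1 \<circ> q \<in> ?L" and p2: "?p2 \<circ> q \<in> ?L" if "q \<in> ?L" for q
    using that H24_perms_closed by blast+
  have inv1: "inv\<^bsub>alt_group 6\<^esub> ?p1 = ?p1 \<circ> ?p1"
    by (rule alt6.inv_equality, simp add: perm_list_comp, simp add: perm_list_eval flip: perm_list_id)
      (intro alt6.m_closed perm_list_in_alt_group)+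
  have inv2: "inv\<^bsub>alt_group 6\<^esub> ?p2 = ?p2"
    by (rule alt6.inv_equality, simp add: perm_list_comp, simp add: perm_list_eval flip: perm_list_id)
      (intro perm_list_in_alt_group)+
  have "\<forall>q\<in>?L. p \<circ> q \<in> ?L" if "p \<in> ?G" for p
    using that
  proof (induction p rule: generate.induct)
    case one
    show ?case
      by (simp add: alt_group_one)
  next
    case (incl h)
    then show ?case
      using p1 p2 by blast
  next
    case (inv h)
    then have "h = ?p1 \<or> h = ?p2"
      by blast
    then show ?case
    proof
      assume "h = ?p1"
      then show ?thesis
        unfolding \<open>h = ?p1\<close> inv1 comp_assoc using p1 by blast
    next
      assume "h = ?p2"
      then show ?thesis
        unfolding \<open>h = ?p2\<close> inv2 using p2 by blast
    qed
  next
    case (eng h1 h2)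
    then show ?case
      unfolding alt_group_mult comp_assoc by blast
  qed
  then show "?G \<subseteq> ?L"
    using id by fastforce
next
  let ?p1 = "perm_list [2, 3, 1, 5, 6, 4]" and ?p2 = "perm_list [4, 2, 6, 1, 5, 3]"
  have p1: "?p1 \<circ> q \<in> ?G" and p2: "?p2 \<circ> q \<in> ?G" if "q \<in> ?G" for q
    using generate.eng[OF generate.incl that, of ?p1] generate.eng[OF generate.incl that, of ?p2]
    by (simp_all add: alt_group_mult)
  \<comment> \<open>Breadth-first search from the identity: every further entry is a generator times
    an entry already reached.\<close>
  have "perm_list [1, 2, 3, 4, 5, 6] \<in> ?G"
    unfolding perm_list_id by (metis alt_group_one generate.one)
  have "perm_list [2, 3, 1, 5, 6, 4] \<in> ?G"
    using p1[OF \<open>perm_list [1, 2, 3, 4, 5, 6] \<in> ?G\<close>] by (simp add: perm_list_comp perm_list_eval)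
  have "perm_list [4, 2, 6, 1, 5, 3] \<in> ?G"
    using p2[OF \<open>perm_list [1, 2, 3, 4, 5, 6] \<in> ?G\<close>] by (simp add: perm_list_comp perm_list_eval)
  have "perm_list [3, 1, 2, 6, 4, 5] \<in> ?G"
    using p1[OF \<open>perm_list [2, 3, 1, 5, 6, 4] \<in> ?G\<close>] by (simp add: perm_list_comp perm_list_eval)
  have "perm_list [2, 6, 4, 5, 3, 1] \<in> ?G"
    using p2[OF \<open>perm_list [2, 3, 1, 5, 6, 4] \<in> ?G\<close>] by (simp add: perm_list_comp perm_list_eval)
  have "perm_list [5, 3, 4, 2, 6, 1] \<in> ?G"
    using p1[OF \<open>perm_list [4, 2, 6, 1, 5, 3] \<in> ?G\<close>] by (simp add: perm_list_comp perm_list_eval)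
  have "perm_list [6, 4, 2, 3, 1, 5] \<in> ?G"
    using p2[OF \<open>perm_list [3, 1, 2, 6, 4, 5] \<in> ?G\<close>] by (simp add: perm_list_comp perm_list_eval)
  have "perm_list [3, 4, 5, 6, 1, 2] \<in> ?G"
    using p1[OF \<open>perm_list [2, 6, 4, 5, 3, 1] \<in> ?G\<close>] by (simp add: perm_list_comp perm_list_eval)
  have "perm_list [6, 1, 5, 3, 4, 2] \<in> ?G"
    using p1[OF \<open>perm_list [5, 3, 4, 2, 6, 1] \<in> ?G\<close>] by (simp add: perm_list_comp perm_list_eval)
  have "perm_list [5, 6, 1, 2, 3, 4] \<in> ?G"
    using p2[OF \<open>perm_list [5, 3, 4, 2, 6, 1] \<in> ?G\<close>] by (simp add: perm_list_comp perm_list_eval)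
  have "perm_list [4, 5, 3, 1, 2, 6] \<in> ?G"
    using p1[OF \<open>perm_list [6, 4, 2, 3, 1, 5] \<in> ?G\<close>] by (simp add: perm_list_comp perm_list_eval)
  have "perm_list [1, 5, 6, 4, 2, 3] \<in> ?G"
    using p1[OF \<open>perm_list [3, 4, 5, 6, 1, 2] \<in> ?G\<close>] by (simp add: perm_list_comp perm_list_eval)
  show "?L \<subseteq> ?G"
    unfolding H24_perms_def list.set image_insert image_empty insert_subset
    by (intro conjI empty_subsetI; fact)
qed

lemma line_perm_image_H24: "line_perm ` carrier H24 = perm_list ` set H24_perms"
proof -
  interpret h: group_hom H24 "alt_group 6" line_perm
    by (rule H24_hom)
  have "subgroup_generated H24 {b1, b2} = H24"
    unfolding H24_def by simp
  then have "line_perm ` carrier H24 = carrier (subgroup_generated (alt_group 6) (line_perm ` {b1, b2}))"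
    using h.subgroup_generated_by_image[of "{b1, b2}"] b_in_H24 by simp
  also have "\<dots> = perm_list ` set H24_perms"
    using generate_H24_perms perm_list_in_alt_group
    by (simp add: carrier_subgroup_generated line_perm_b Int_absorb1)
  finally show ?thesis .
qed

lemma order_H24: "order H24 = 24"
proof -
  have "inj_on perm_list (set H24_perms)"
    by (rule inj_on_subset[OF inj_on_perm_list[of 6]]) (simp add: H24_perms_def)
  then have "card (line_perm ` carrier H24) = card (set H24_perms)"
    by (simp add: line_perm_image_H24 card_image)
  also have "\<dots> = 12"
    by (simp add: H24_perms_def)
  finally show ?thesis
    using group_hom.order_eq_card_kernel_image[OF H24_hom]
    by (simp add: kernel_line_perm_H24 card_pm_one)
qed

text \<open>Three-cycles generate the alternating group. Up to rotation and inversion a 3-cycle is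
  determined by its support, so it is enough to reach the 20 three-element subsets from one of them
  by conjugating with the four generators.\<close>

lemma three_cycles_subset_line_perm_image: "three_cycles 6 \<subseteq> line_perm ` carrier H720"
proof -
  interpret h: group_hom H720 "alt_group 6" line_perm
    by (rule H720_hom)
  let ?M = "line_perm ` carrier H720"
  have b: "line_perm b1 \<in> ?M" "line_perm b2 \<in> ?M" "line_perm b3 \<in> ?M" "line_perm b4 \<in> ?M"
    using b_in_H720 by auto
  have M: "p \<circ> q \<in> ?M" if "p \<in> ?M" "q \<in> ?M" for p q
    using subgroup.m_closed[OF h.img_is_subgroup that] by (simp add: alt_group_mult)
  have M_inv: "inv' p \<in> ?M" if "p \<in> ?M" for p
    using subgroup.m_inv_closed[OF h.img_is_subgroup that] subgroup.mem_carrier[OF h.img_is_subgroup that]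
    by (simp add: alt_group_inv_equality)
  \<comment> \<open>Distinctness is carried along because conjugation relabels the entries of
    \<open>cycle_of_list\<close> only for a genuine cycle.\<close>
  define good where "good a b c \<longleftrightarrow> distinct [a, b, c] \<and> cycle_of_list [a, b, c] \<in> ?M" for a b c
  have rot: "good b c a" if "good a b c" for a b c
  proof -
    have "cycle_of_list [b, c, a] = cycle_of_list [a, b, c]"
      using that by (auto simp: good_def fun_eq_iff Transposition.transpose_def)
    then show ?thesis
      using that by (auto simp: good_def)
  qed
  have rev: "good a c b" if "good a b c" for a b c
  proof -
    have "cycle_of_list [a, c, b] = cycle_of_list [a, b, c] \<circ> cycle_of_list [a, b, c]"
      using that by (auto simp: good_def fun_eq_iff Transposition.transpose_def)
    then show ?thesis
      using that M[of "cycle_of_list [a, b, c]" "cycle_of_list [a, b, c]"] by (auto simp: good_def)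
  qed
  have conj0: "good (p a) (p b) (p c)" if "good a b c" "p \<in> ?M" for a b c p
  proof -
    have "p \<in> carrier (alt_group 6)"
      using subgroup.mem_carrier[OF h.img_is_subgroup that(2)] .
    then have "bij p"
      using alt_group_permutes permutes_bij by blast
    moreover have "cycle [a, b, c]"
      using that(1) by (simp add: good_def)
    ultimately have "p \<circ> cycle_of_list [a, b, c] \<circ> inv' p = cycle_of_list [p a, p b, p c]"
      using conjugation_of_cycle[of "[a, b, c]" p] by simp
    moreover have "p \<circ> cycle_of_list [a, b, c] \<circ> inv' p \<in> ?M"
      using that by (intro M M_inv) (auto simp: good_def)
    moreover have "distinct [p a, p b, p c]"
      using \<open>bij p\<close> \<open>cycle [a, b, c]\<close> by (simp add: bij_is_inj inj_eq)
    ultimately show ?thesis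
      unfolding good_def by metis
  qed
  note conj = conj0[OF _ b(1), unfolded line_perm_b] conj0[OF _ b(2), unfolded line_perm_b]
    conj0[OF _ b(3), unfolded line_perm_b] conj0[OF _ b(4), unfolded line_perm_b]
  have "good 1 2 3"
  proof -
    \<comment> \<open>\<open>b1\<close> acts as (1 2 3)(4 5 6) and the product of \<open>b3\<close>
      and \<open>b4\<close> as (1 2 3)(4 6 5). On 4, 5, 6 the two cancel, and on 1, 2, 3 the square
      of a 3-cycle remains.\<close>
    have "line_perm b1 \<circ> (line_perm b3 \<circ> line_perm b4) = perm_list [3, 1, 2, 4, 5, 6]"
      unfolding line_perm_b by (simp add: perm_list_comp perm_list_eval)
    also have "\<dots> = cycle_of_list [1, 3, 2]"
    proof
      fix i :: nat
      have "i = 0 \<or> i \<in> {1, 2, 3, 4, 5, 6} \<or> i > 6"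
        by force
      then show "perm_list [3, 1, 2, 4, 5, 6] i = cycle_of_list [1, 3, 2] i"
        by (auto simp: perm_list_def Transposition.transpose_def)
    qed
    finally have "cycle_of_list [1, 3, 2] \<in> ?M"
      using M[OF b(1) M[OF b(3) b(4)]] by simp
    then have "good 1 3 2"
      by (simp add: good_def)
    then show ?thesis
      by (rule rev)
  qed
  \<comment> \<open>One representative for each of the remaining 19 supports; \<open>conj(1)\<close>
    to \<open>conj(4)\<close> are conjugation by the images of \<open>b1\<close> to
    \<open>b4\<close>.\<close>
  have "good 4 2 6"
    using conj(2)[OF \<open>good 1 2 3\<close>] by (simp add: perm_list_eval)
  have "good 5 3 4"
    using conj(1)[OF \<open>good 4 2 6\<close>] by (simp add: perm_list_eval)
  have "good 5 3 6"
    using conj(3)[OF \<open>good 4 2 6\<close>] by (simp add: perm_list_eval)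
  have "good 6 1 5"
    using conj(1)[OF \<open>good 5 3 4\<close>] by (simp add: perm_list_eval)
  have "good 4 2 5"
    using conj(3)[OF \<open>good 5 3 4\<close>] by (simp add: perm_list_eval)
  have "good 6 1 4"
    using conj(1)[OF \<open>good 5 3 6\<close>] by (simp add: perm_list_eval)
  have "good 5 1 4"
    using conj(4)[OF \<open>good 5 3 6\<close>] by (simp add: perm_list_eval)
  have "good 1 2 5"
    using conj(2)[OF \<open>good 4 2 5\<close>] by (simp add: perm_list_eval)
  have "good 6 2 5"
    using conj(4)[OF \<open>good 4 2 5\<close>] by (simp add: perm_list_eval)
  have "good 3 4 1"
    using conj(2)[OF \<open>good 6 1 4\<close>] by (simp add: perm_list_eval)
  have "good 4 3 6"
    using conj(4)[OF \<open>good 6 1 4\<close>] by (simp add: perm_list_eval)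
  have "good 2 3 6"
    using conj(1)[OF \<open>good 1 2 5\<close>] by (simp add: perm_list_eval)
  have "good 3 2 5"
    using conj(4)[OF \<open>good 1 2 5\<close>] by (simp add: perm_list_eval)
  have "good 1 6 3"
    using conj(4)[OF \<open>good 3 4 1\<close>] by (simp add: perm_list_eval)
  have "good 2 1 4"
    using conj(4)[OF \<open>good 2 3 6\<close>] by (simp add: perm_list_eval)
  have "good 2 3 4"
    using conj(3)[OF \<open>good 3 2 5\<close>] by (simp add: perm_list_eval)
  have "good 1 6 2"
    using conj(3)[OF \<open>good 1 6 3\<close>] by (simp add: perm_list_eval)
  have "good 3 1 5"
    using conj(3)[OF \<open>good 2 1 4\<close>] by (simp add: perm_list_eval)
  have "good 6 4 5"
    using conj(2)[OF \<open>good 3 1 5\<close>] by (simp add: perm_list_eval)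
  have sorted: "good a b c" if "a < b" "b < c" "1 \<le> a" "c \<le> 6" for a b c :: nat
  proof -
    \<comment> \<open>Rotation and inversion bring each of the 20 representatives into increasing
      order.\<close>
    have *: "\<forall>a\<in>{1, 2, 3, 4}. \<forall>b\<in>{2, 3, 4, 5}. \<forall>c\<in>{3, 4, 5, 6}. a < b \<longrightarrow> b < c \<longrightarrow> good a b c"
      by (simp add:
          \<open>good 1 2 3\<close>[unfolded One_nat_def]
          \<open>good 2 1 4\<close>[THEN rev, THEN rot, THEN rot, unfolded One_nat_def]
          \<open>good 1 2 5\<close>[unfolded One_nat_def]
          \<open>good 1 6 2\<close>[THEN rev, unfolded One_nat_def]
          \<open>good 3 4 1\<close>[THEN rot, THEN rot, unfolded One_nat_def]
          \<open>good 3 1 5\<close>[THEN rev, THEN rot, THEN rot, unfolded One_nat_def]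
          \<open>good 1 6 3\<close>[THEN rev, unfolded One_nat_def]
          \<open>good 5 1 4\<close>[THEN rot, unfolded One_nat_def]
          \<open>good 6 1 4\<close>[THEN rot, unfolded One_nat_def]
          \<open>good 6 1 5\<close>[THEN rot, unfolded One_nat_def]
          \<open>good 2 3 4\<close>[unfolded One_nat_def]
          \<open>good 3 2 5\<close>[THEN rev, THEN rot, THEN rot, unfolded One_nat_def]
          \<open>good 2 3 6\<close>[unfolded One_nat_def]
          \<open>good 4 2 5\<close>[THEN rev, THEN rot, THEN rot, unfolded One_nat_def]
          \<open>good 4 2 6\<close>[THEN rev, THEN rot, THEN rot, unfolded One_nat_def]
          \<open>good 6 2 5\<close>[THEN rot, unfolded One_nat_def]
          \<open>good 5 3 4\<close>[THEN rot, unfolded One_nat_def]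
          \<open>good 4 3 6\<close>[THEN rev, THEN rot, THEN rot, unfolded One_nat_def]
          \<open>good 5 3 6\<close>[THEN rev, THEN rot, THEN rot, unfolded One_nat_def]
          \<open>good 6 4 5\<close>[THEN rot, unfolded One_nat_def])
    have "a \<in> {1, 2, 3, 4}" "b \<in> {2, 3, 4, 5}" "c \<in> {3, 4, 5, 6}"
      using that by auto
    with * that show ?thesis
      by blast
  qed
  have all: "good a b c" if "{a, b, c} \<subseteq> {1..6}" "distinct [a, b, c]" for a b c :: nat
  proof -
    have "a \<noteq> b" "b \<noteq> c" "a \<noteq> c"
      using that(2) by auto
    then consider "a < b" "b < c" | "a < c" "c < b" | "b < a" "a < c" | "b < c" "c < a"
      | "c < a" "a < b" | "c < b" "b < a"
      by linarith
    then show ?thesis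
    proof cases
      case 1
      with that show ?thesis
        by (intro sorted) auto
    next
      case 2
      with that show ?thesis
        by (intro sorted[THEN rev]) auto
    next
      case 3
      with that show ?thesis
        by (intro sorted[THEN rev, THEN rot, THEN rot]) auto
    next
      case 4
      with that show ?thesis
        by (intro sorted[THEN rot, THEN rot]) auto
    next
      case 5
      with that show ?thesis
        by (intro sorted[THEN rot]) auto
    next
      case 6
      with that show ?thesis
        by (intro sorted[THEN rev, THEN rot]) auto
    qed
  qed
  have "cycle_of_list cs \<in> ?M" if cs: "cycle cs" "length cs = 3" "set cs \<subseteq> {1..6}" for cs
  proof -
    obtain a b c where "cs = [a, b, c]"
      using cs(2) by (auto simp: eval_nat_numeral length_Suc_conv)
    with cs all[of a b c] show ?thesis
      by (simp add: good_def)
  qed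
  then show ?thesis
    by blast
qed

lemma line_perm_image_H720: "line_perm ` carrier H720 = carrier (alt_group 6)"
proof -
  interpret h: group_hom H720 "alt_group 6" line_perm
    by (rule H720_hom)
  show ?thesis
    using alt6.generate_subgroup_incl[OF three_cycles_subset_line_perm_image h.img_is_subgroup]
      alt_group_carrier_as_three_cycles[of 6] h.hom_closed by blast
qed

lemma order_H720: "order H720 = 720"
proof -
  have "(fact 6 :: nat) = 720"
    by (simp add: fact_numeral)
  then have "card (line_perm ` carrier H720) = 360"
    using alt_group_card_carrier[of 6] by (simp add: line_perm_image_H720)
  then show ?thesis
    using group_hom.order_eq_card_kernel_image[OF H720_hom]
    by (simp add: kernel_line_perm card_pm_one)
qed

section \<open>The central extension\<close>

lemma uminus_one_mult: "(- mat 1) ** A = - A" "A ** (- mat 1) = - A" for A :: "quat ^ 2 ^ 2"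
  by (simp_all add: matrix_eq2 matrix_matrix_mult_def mat_def sum_2)

text \<open>The two elements act on the lines as (1 4)(3 6) and (1 4)(2 5). These commute, so the
  commutator can only be 1 or -1; the matrices themselves anticommute, like two of the units i, j,
  k.\<close>

lemma b2_commutator:
  "b2 ** (b1 ** b2 ** inv\<^bsub>unitary_group\<^esub> b1) ** inv\<^bsub>unitary_group\<^esub> b2 **
     inv\<^bsub>unitary_group\<^esub> (b1 ** b2 ** inv\<^bsub>unitary_group\<^esub> b1) = - mat 1"
proof -
  \<comment> \<open>Conjugating by \<open>b1\<close>, which is diagonal with entries 1 and \<omega>,
    keeps the diagonal of \<open>b2\<close> and multiplies the upper and lower off-diagonal entries
    by the conjugate of \<omega> and by \<omega>.\<close>
  let ?y = "mat2 (Quat 0 (1 / sqrt 3) 0 0) (Quat (- (sqrt 2 / (2 * sqrt 3))) (- (sqrt 2 / 2)) 0 0)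
             (Quat (sqrt 2 / (2 * sqrt 3)) (- (sqrt 2 / 2)) 0 0) (Quat 0 (- (1 / sqrt 3)) 0 0)"
  have y: "b1 ** b2 ** inv\<^bsub>unitary_group\<^esub> b1 = ?y"
    unfolding inv_unitary_group[OF b_unitary(1)] unfolding b1_def b2_def cadjoint_mat2 mat2_mult mat2_eq_iff
    by (simp add: quat_ring_defs sqrt_simps field_simps)
  have "b1 ** b2 ** inv\<^bsub>unitary_group\<^esub> b1 \<in> carrier unitary_group"
    by (intro U.m_closed U.inv_closed b_unitary)
  then have "?y \<in> carrier unitary_group"
    by (simp only: y)
  then show ?thesis
    unfolding y inv_unitary_group[OF b_unitary(2)] inv_unitary_group[OF \<open>?y \<in> carrier unitary_group\<close>]
    unfolding b2_def cadjoint_mat2 mat2_mult mat_eq_mat2 uminus_mat2 mat2_eq_iff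
    by (simp add: quat_ring_defs sqrt_simps field_simps)
qed

lemma double_cover_H720: "double_cover H720 (alt_group 6)"
  unfolding double_cover_def
proof (intro conjI bexI)
  show "group H720" "group (alt_group 6)"
    by (rule group_H720 alt_group_is_group)+
  interpret h: group_hom H720 "alt_group 6" line_perm
    by (rule H720_hom)
  show "line_perm \<in> epi H720 (alt_group 6)"
    using h.homh line_perm_image_H720 by (simp add: epi_def)
  show "card (kernel H720 (alt_group 6) line_perm) = 2"
    by (simp add: kernel_line_perm card_pm_one)
  show "\<forall>z\<in>kernel H720 (alt_group 6) line_perm. \<forall>g\<in>carrier H720. z \<otimes>\<^bsub>H720\<^esub> g = g \<otimes>\<^bsub>H720\<^esub> z"
    by (simp add: kernel_line_perm uminus_one_mult)
  let ?y = "b1 ** b2 ** inv\<^bsub>H720\<^esub> b1"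
  have inv: "inv\<^bsub>H720\<^esub> A = inv\<^bsub>unitary_group\<^esub> A" if "A \<in> carrier H720" for A
    using that unfolding H720_def by (rule U.inv_subgroup_generated)
  have y: "?y \<in> carrier H720"
    by (intro H720.m_closed H720.inv_closed b_in_H720)
  have "- mat 1 = b2 ** ?y ** inv\<^bsub>H720\<^esub> b2 ** inv\<^bsub>H720\<^esub> ?y"
    using b2_commutator y b_in_H720 by (simp add: inv)
  then have "- mat 1 \<in> derived_set H720 (carrier H720)"
    using y b_in_H720(2) by auto
  then have "- mat 1 \<in> derived H720 (carrier H720)"
    unfolding derived_def by (rule generate.incl)
  moreover have "mat 1 \<in> derived H720 (carrier H720)"
    unfolding derived_def using generate.one[of H720] by simp
  ultimately show "kernel H720 (alt_group 6) line_perm \<subseteq> derived H720 (carrier H720)"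
    by (simp add: kernel_line_perm)
qed

section \<open>Irreducibility\<close>

lemma right_subspace_diff: "right_subspace W \<Longrightarrow> v \<in> W \<Longrightarrow> w \<in> W \<Longrightarrow> v - w \<in> W"
proof -
  assume W: "right_subspace W" "v \<in> W" "w \<in> W"
  have "rscale w (- 1) = - w"
    by (simp add: rscale_def vec_eq_iff)
  then have "- w \<in> W"
    using W by (metis right_subspace_def)
  then show ?thesis
    using W by (metis right_subspace_def diff_conv_add_uminus)
qed

text \<open>\<open>b1\<close> minus the identity annihilates the first coordinate and scales the
  second, so any vector with nonzero second coordinate yields the second basis vector. As
  \<open>b2\<close> has nonzero off-diagonal entries, it leads from either coordinate line to the
  other.\<close>

lemma irreducible_H720: "irreducible_group H720"
  unfolding irreducible_group_def
proof (intro allI impI)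
  fix W
  assume *: "right_subspace W \<and> (\<forall>A\<in>carrier H720. (*v) A ` W \<subseteq> W)"
  then have inv: "A *v v \<in> W" if "A \<in> carrier H720" "v \<in> W" for A v
    using that by blast
  have W: "right_subspace W"
    using * by blast
  have scale: "rscale v c \<in> W" if "v \<in> W" for v c
    using W that by (simp add: right_subspace_def)
  have 1: "vector [1, 0] \<in> W" if "vector [x, 0] \<in> W" "x \<noteq> 0" for x
    using scale[OF that(1), of "inverse x"] that(2) by (simp add: rscale_vector2)
  have 2: "vector [0, 1] \<in> W" if "vector [x, y] \<in> W" "y \<noteq> 0" for x y
  proof -
    \<comment> \<open>This is \<omega> - 1.\<close>
    let ?w = "Quat (- 3 / 2) (sqrt 3 / 2) 0 0"
    have "b1 *v vector [x, y] - vector [x, y] = vector [0, ?w * y]"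
      by (simp add: b1_def mat2_vector vec_eq_iff forall_2 quat_ring_defs algebra_simps)
    then have "vector [0, ?w * y] \<in> W"
      using right_subspace_diff[OF W inv[OF b_in_H720(1) that(1)] that(1)] by simp
    moreover have "?w \<noteq> 0"
      by (simp add: zero_quat_def)
    then have "?w * y \<noteq> 0"
      using that(2) by simp
    ultimately show ?thesis
      using scale[of "vector [0, ?w * y]" "inverse (?w * y)"] by (simp add: rscale_vector2)
  qed
  show "W = {0} \<or> W = UNIV"
  proof (cases "W = {0}")
    case False
    have "0 \<in> W"
      using W by (simp add: right_subspace_def)
    with False obtain v where v: "v \<in> W" "v \<noteq> 0"
      by blast
    obtain x y where xy: "v = vector [x, y]"
      by (rule vector2_cases)
    have e2: "vector [0, 1] \<in> W"
    proof (cases "y = 0")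
      case True
      with v xy have "vector [1, 0] \<in> W"
        using 1[of x] by (auto simp: vector2_eq_0_iff)
      then have "b2 *v vector [1, 0] \<in> W"
        by (rule inv[OF b_in_H720(2)])
      moreover have "b2 *v vector [1, 0] =
          vector [Quat 0 (1 / sqrt 3) 0 0, Quat (- (sqrt 2 / sqrt 3)) 0 0 0]"
        by (simp add: b2_def mat2_vector)
      ultimately show ?thesis
        by (intro 2[of "Quat 0 (1 / sqrt 3) 0 0" "Quat (- (sqrt 2 / sqrt 3)) 0 0 0"])
          (simp_all add: zero_quat_def)
    next
      case False
      with v xy show ?thesis
        using 2 by blast
    qed
    \<comment> \<open>The second column of \<open>b2\<close>; removing the multiple of the second
      basis vector leaves a vector on the first coordinate line.\<close>
    let ?c = "Quat (sqrt 2 / sqrt 3) 0 0 0" and ?d = "Quat 0 (- (1 / sqrt 3)) 0 0"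
    have "b2 *v vector [0, 1] \<in> W"
      by (rule inv[OF b_in_H720(2) e2])
    then have "b2 *v vector [0, 1] - rscale (vector [0, 1]) ?d \<in> W"
      by (intro right_subspace_diff[OF W] scale e2)
    moreover have "b2 *v vector [0, 1] - rscale (vector [0, 1]) ?d = vector [?c, 0]"
      by (simp add: b2_def mat2_vector rscale_vector2 vec_eq_iff forall_2)
    ultimately have e1: "vector [1, 0] \<in> W"
      by (intro 1[of ?c]) (simp_all add: zero_quat_def)
    have "u \<in> W" for u
    proof -
      have "u = rscale (vector [1, 0]) (u $ 1) + rscale (vector [0, 1]) (u $ 2)"
        by (simp add: rscale_vector2 vec_eq_iff forall_2)
      then show ?thesis
        using W scale[OF e1] scale[OF e2] by (metis right_subspace_def)
    qed
    then show ?thesis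
      by blast
  qed simp
qed

section \<open>Orbits of the six lines\<close>

lemma H24_perms_transitive: "i \<in> {1..6} \<Longrightarrow> (\<lambda>xs. perm_list xs i) ` set H24_perms = {1..6}"
  unfolding atLeastAtMost_1_6
  by (elim insertE emptyE; hypsubst; simp add: H24_perms_def perm_list_def; auto)

lemma image_six_line:
  "A \<in> carrier H720 \<Longrightarrow> i \<in> {1..6} \<Longrightarrow> (*v) A ` six_line i = six_line (line_perm A i)"
  using acts_H720 unfolding acts_def by blast

lemma line_orbit_H24: "L \<in> six_lines \<Longrightarrow> line_orbit H24 L = six_lines"
proof -
  assume "L \<in> six_lines"
  then obtain i where i: "i \<in> {1..6}" "L = six_line i"
    by (auto simp: six_lines_eq)
  have "line_orbit H24 L = (\<lambda>A. six_line (line_perm A i)) ` carrier H24"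
    unfolding line_orbit_def i(2)
    using H24_subset_H720 i(1) by (intro image_cong image_six_line) auto
  also have "\<dots> = six_line ` (\<lambda>p. p i) ` line_perm ` carrier H24"
    by (simp add: image_image)
  also have "(\<lambda>p. p i) ` line_perm ` carrier H24 = {1..6}"
    using H24_perms_transitive[OF i(1)] by (simp add: line_perm_image_H24 image_image)
  finally show ?thesis
    by (simp add: six_lines_eq)
qed

lemma line_orbit_H720: "L \<in> six_lines \<Longrightarrow> line_orbit H720 L = six_lines"
proof
  assume L: "L \<in> six_lines"
  show "six_lines \<subseteq> line_orbit H720 L"
    using line_orbit_H24[OF L] H24_subset_H720 unfolding line_orbit_def by blast
  obtain i where i: "i \<in> {1..6}" "L = six_line i"
    using L by (auto simp: six_lines_eq)
  show "line_orbit H720 L \<subseteq> six_lines"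
  proof
    fix M
    assume "M \<in> line_orbit H720 L"
    then obtain A where "A \<in> carrier H720" "M = (*v) A ` six_line i"
      by (auto simp: line_orbit_def i(2))
    then show "M \<in> six_lines"
      unfolding six_lines_eq using image_six_line[OF _ i(1)] acts_in[OF acts_H720 i(1)] by blast
  qed
qed

section \<open>Complex matrices\<close>

definition c1 :: "complex ^ 2 ^ 2" where
  "c1 = mat2 1 0 0 (Complex (- 1 / 2) (sqrt 3 / 2))"

definition c2 :: "complex ^ 2 ^ 2" where
  "c2 = mat2 (Complex 0 (1 / sqrt 3)) (Complex (sqrt 2 / sqrt 3) 0)
             (Complex (- (sqrt 2 / sqrt 3)) 0) (Complex 0 (- (1 / sqrt 3)))"

lemma quat_of_complex_simps [simp]:
  "quat_of_complex 0 = 0" "quat_of_complex 1 = 1"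
  "quat_of_complex (x + y) = quat_of_complex x + quat_of_complex y"
  "quat_of_complex (x * y) = quat_of_complex x * quat_of_complex y"
  "quat_of_complex (cnj x) = conjugate (quat_of_complex x)"
  "quat_of_complex x = quat_of_complex y \<longleftrightarrow> x = y"
  "quat_of_complex (Complex a b) = Quat a b 0 0"
  by (auto simp: quat_of_complex_def quat_ring_defs complex_eq_iff)

lemma quat_matrix_mat2:
  "quat_matrix (mat2 a b c d) =
     mat2 (quat_of_complex a) (quat_of_complex b) (quat_of_complex c) (quat_of_complex d)"
  by (simp add: quat_matrix_def matrix_eq2)

lemma quat_matrix_mult: "quat_matrix (A ** B) = quat_matrix A ** quat_matrix B"
  for A B :: "complex ^ 2 ^ 2"
  by (cases A rule: mat2_cases, cases B rule: mat2_cases) (simp add: mat2_mult quat_matrix_mat2)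

lemma quat_matrix_cadjoint: "quat_matrix (cadjoint A) = cadjoint (quat_matrix A)"
  for A :: "complex ^ 2 ^ 2"
  by (cases A rule: mat2_cases) (simp add: cadjoint_mat2 quat_matrix_mat2 conjugate_complex_def)

lemma quat_matrix_one: "quat_matrix (mat 1 :: complex ^ 2 ^ 2) = mat 1"
  by (simp add: mat_eq_mat2 quat_matrix_mat2)

lemma quat_matrix_eq_iff: "quat_matrix A = quat_matrix B \<longleftrightarrow> A = B"
  by (simp add: quat_matrix_def vec_eq_iff)

lemma quat_matrix_unitary_iff:
  "quat_matrix A \<in> carrier unitary_group \<longleftrightarrow> A \<in> carrier unitary_group" for A :: "complex ^ 2 ^ 2"
  unfolding unitary_iff
  by (simp flip: quat_matrix_cadjoint quat_matrix_mult quat_matrix_one add: quat_matrix_eq_iff)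

lemma quat_matrix_hom:
  "group_hom (unitary_group :: (complex ^ 2 ^ 2) monoid) unitary_group quat_matrix"
  by (intro group_hom.intro group_hom_axioms.intro group_unitary_group)
    (auto simp: hom_def quat_matrix_unitary_iff quat_matrix_mult)

lemma quat_matrix_c: "quat_matrix c1 = b1" "quat_matrix c2 = b2"
  by (simp_all add: c1_def c2_def b1_def b2_def quat_matrix_mat2)

lemma c_unitary: "c1 \<in> carrier unitary_group" "c2 \<in> carrier unitary_group"
  using b_unitary by (simp_all flip: quat_matrix_c add: quat_matrix_unitary_iff)

lemma carrier_H24: "carrier H24 = quat_matrix ` carrier (subgroup_generated unitary_group {c1, c2})"
  using group_hom.subgroup_generated_by_image[OF quat_matrix_hom, of "{c1, c2}"] c_unitary
  by (simp add: H24_def quat_matrix_c)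

text \<open>\<open>quat_matrix\<close> is injective and \<open>H24\<close> is the image of the group
  generated by \<open>c1\<close> and \<open>c2\<close>, so pulling back recovers exactly that
  group.\<close>

lemma complex_matrices_of_H24:
  "complex_matrices_of H24 = subgroup_generated unitary_group {c1, c2}"
proof -
  have "{A. quat_matrix A \<in> carrier H24} = carrier (subgroup_generated unitary_group {c1, c2})"
    unfolding carrier_H24 by (auto simp: quat_matrix_eq_iff)
  then show ?thesis
    by (simp add: complex_matrices_of_def subgroup_generated_def)
qed

text \<open>With r = \<open>c1\<close> and s its conjugate by \<open>c2\<close>, this reads r s r =
  \<open>c2\<close>, and since s \<open>c2\<close> = \<open>c2\<close> r it entails the braid
  relation r s r = s r s, characteristic of two order-3 reflections generating the Shephard-Todd
  group 4. It displays \<open>c2\<close> as a product of reflections.\<close>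

lemma c_braid: "c1 ** (c2 ** c1 ** cadjoint c2) ** c1 = c2"
  unfolding c1_def c2_def cadjoint_mat2 mat2_mult mat2_eq_iff
  by (simp add: complex_eq_iff conjugate_complex_def sqrt_simps algebra_simps)

lemma b_braid: "b1 ** (b2 ** b1 ** cadjoint b2) ** b1 = b2"
  using arg_cong[OF c_braid, of quat_matrix]
  by (simp add: quat_matrix_mult quat_matrix_cadjoint quat_matrix_c)

section \<open>Reflections\<close>

lemma b1_reflection_conjugate:
  assumes "g \<in> carrier unitary_group"
  shows "reflection (g ** b1 ** inv\<^bsub>unitary_group\<^esub> g)"
proof (rule reflection_conjugate[OF b_unitary(1) assms])
  show "b1 \<noteq> mat 1"
    by (simp add: b1_def mat_eq_mat2 mat2_eq_iff one_quat_def)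
  show "vector [1, 0] \<noteq> (0 :: quat ^ 2)"
    by (simp add: vector2_eq_0_iff)
  show "b1 *v vector [1, 0] = vector [1, 0]"
    by (simp add: b1_def mat2_vector)
qed

lemma c1_reflection_conjugate:
  assumes "g \<in> carrier unitary_group"
  shows "reflection (g ** c1 ** inv\<^bsub>unitary_group\<^esub> g)"
proof (rule reflection_conjugate[OF c_unitary(1) assms])
  show "c1 \<noteq> mat 1"
    by (simp add: c1_def mat_eq_mat2 mat2_eq_iff complex_eq_iff)
  show "vector [1, 0] \<noteq> (0 :: complex ^ 2)"
    by (simp add: vector2_eq_0_iff)
  show "c1 *v vector [1, 0] = vector [1, 0]"
    by (simp add: c1_def mat2_vector)
qed

lemma reflection_groupI:
  fixes S R :: "('a::involutive_div_algebra ^ 2 ^ 2) set"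
  assumes "\<And>A. A \<in> R \<Longrightarrow> reflection A" "R \<subseteq> carrier (subgroup_generated unitary_group S)"
    and "S \<subseteq> generate unitary_group R"
  shows "reflection_group (subgroup_generated unitary_group S)"
proof -
  have R: "R \<subseteq> carrier unitary_group"
    using assms(1) by (auto simp: reflection_def)
  have "generate unitary_group (carrier unitary_group \<inter> S) = generate unitary_group R"
  proof
    show "generate unitary_group (carrier unitary_group \<inter> S) \<subseteq> generate unitary_group R"
      using assms(3) U.generate_is_subgroup[OF R] by (intro U.generate_subgroup_incl) auto
    show "generate unitary_group R \<subseteq> generate unitary_group (carrier unitary_group \<inter> S)"
      using assms(2) by (intro U.generate_subgroup_incl U.generate_is_subgroup)
        (auto simp: carrier_subgroup_generated)
  qed
  then have "subgroup_generated unitary_group S = subgroup_generated unitary_group R"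
    using R by (simp add: subgroup_generated_def Int_absorb1)
  then show ?thesis
    using assms(1) unfolding reflection_group_def by blast
qed

lemma line_perm_eq_imp:
  assumes "A \<in> carrier H720" "B \<in> carrier H720" "line_perm A = line_perm B"
  shows "A = B \<or> A = - B"
proof -
  interpret h: group_hom H720 "alt_group 6" line_perm
    by (rule H720_hom)
  have "line_perm (A ** inv\<^bsub>H720\<^esub> B) = line_perm (B ** inv\<^bsub>H720\<^esub> B)"
    using assms h.hom_mult[of A "inv\<^bsub>H720\<^esub> B"] h.hom_mult[of B "inv\<^bsub>H720\<^esub> B"]
    by (simp add: H720.inv_closed)
  also have "\<dots> = id"
    using assms(2) h.hom_one by (simp add: H720.r_inv alt_group_one)
  finally have "A ** inv\<^bsub>H720\<^esub> B \<in> kernel H720 (alt_group 6) line_perm"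
    using assms by (simp add: kernel_def alt_group_one H720.m_closed H720.inv_closed)
  then have "A ** inv\<^bsub>H720\<^esub> B = mat 1 \<or> A ** inv\<^bsub>H720\<^esub> B = - mat 1"
    by (simp add: kernel_line_perm)
  moreover have "A = (A ** inv\<^bsub>H720\<^esub> B) ** B"
    using assms by (simp add: H720.m_assoc H720.inv_closed H720.l_inv)
  ultimately show ?thesis
    by (metis matrix_mul_lid uminus_one_mult(1))
qed

lemma inv_involution: "p \<circ> p = id \<Longrightarrow> inv' p = p"
  by (rule inv_unique_comp)

lemma inv_perm_list:
  "inv' (perm_list [4, 2, 6, 1, 5, 3]) = perm_list [4, 2, 6, 1, 5, 3]"
  "inv' (perm_list [1, 3, 2, 5, 4, 6]) = perm_list [1, 3, 2, 5, 4, 6]"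
  "inv' (perm_list [3, 2, 1, 6, 5, 4]) = perm_list [3, 2, 1, 6, 5, 4]"
  by (rule inv_involution, simp add: perm_list_comp, simp add: perm_list_eval flip: perm_list_id)+

text \<open>Both equations have the shape of \<open>b_braid\<close>, r (g r g^{-1}) r = g with r a
  conjugate of the permutation of \<open>b1\<close>: first r comes from conjugating by
  \<open>b2\<close> and g is that of \<open>b3\<close>, then r comes from conjugating by the product
  of \<open>b3\<close> and \<open>b2\<close> and g is that of \<open>b4\<close>.\<close>

lemma b3_b4_perms:
  fixes conj :: "(nat \<Rightarrow> nat) \<Rightarrow> nat \<Rightarrow> nat"
  defines "conj \<equiv> \<lambda>p. p \<circ> perm_list [2, 3, 1, 5, 6, 4] \<circ> inv' p"
    and "p2 \<equiv> perm_list [4, 2, 6, 1, 5, 3]" and "p3 \<equiv> perm_list [1, 3, 2, 5, 4, 6]"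
    and "p4 \<equiv> perm_list [3, 2, 1, 6, 5, 4]"
  shows "conj p2 \<circ> conj (p3 \<circ> p2) \<circ> conj p2 = p3"
    and "conj (p3 \<circ> p2) \<circ> conj (p4 \<circ> (p3 \<circ> p2)) \<circ> conj (p3 \<circ> p2) = p4"
proof -
  have bij: "bij p2" "bij p3" "bij p4"
    unfolding p2_def p3_def p4_def
    using perm_list_in_alt_group alt_group_permutes permutes_bij by blast+
  have invp: "inv' p2 = p2" "inv' p3 = p3" "inv' p4 = p4"
    unfolding p2_def p3_def p4_def by (rule inv_perm_list)+
  have conj_comp: "conj (p \<circ> q) = p \<circ> conj q \<circ> inv' p" if "bij p" "bij q" for p q
    using that by (simp add: conj_def o_inv_distrib comp_assoc)
  have e0: "perm_list [4, 2, 6, 1, 5, 3] \<circ> perm_list [2, 3, 1, 5, 6, 4] = perm_list [2, 6, 4, 5, 3, 1]"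
    by (simp add: perm_list_comp) (simp add: perm_list_eval)
  have e1: "perm_list [2, 6, 4, 5, 3, 1] \<circ> perm_list [4, 2, 6, 1, 5, 3] = perm_list [5, 6, 1, 2, 3, 4]"
    by (simp add: perm_list_comp) (simp add: perm_list_eval)
  have e2: "perm_list [1, 3, 2, 5, 4, 6] \<circ> perm_list [5, 6, 1, 2, 3, 4] = perm_list [4, 6, 1, 3, 2, 5]"
    by (simp add: perm_list_comp) (simp add: perm_list_eval)
  have e3: "perm_list [4, 6, 1, 3, 2, 5] \<circ> perm_list [1, 3, 2, 5, 4, 6] = perm_list [4, 1, 6, 2, 3, 5]"
    by (simp add: perm_list_comp) (simp add: perm_list_eval)
  have e4: "perm_list [3, 2, 1, 6, 5, 4] \<circ> perm_list [4, 1, 6, 2, 3, 5] = perm_list [6, 3, 4, 2, 1, 5]"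
    by (simp add: perm_list_comp) (simp add: perm_list_eval)
  have e5: "perm_list [6, 3, 4, 2, 1, 5] \<circ> perm_list [3, 2, 1, 6, 5, 4] = perm_list [4, 3, 6, 5, 1, 2]"
    by (simp add: perm_list_comp) (simp add: perm_list_eval)
  have e6: "perm_list [5, 6, 1, 2, 3, 4] \<circ> perm_list [4, 1, 6, 2, 3, 5] = perm_list [2, 5, 4, 6, 1, 3]"
    by (simp add: perm_list_comp) (simp add: perm_list_eval)
  have e7: "perm_list [2, 5, 4, 6, 1, 3] \<circ> perm_list [5, 6, 1, 2, 3, 4] = perm_list [1, 3, 2, 5, 4, 6]"
    by (simp add: perm_list_comp) (simp add: perm_list_eval)
  have e8: "perm_list [4, 1, 6, 2, 3, 5] \<circ> perm_list [4, 3, 6, 5, 1, 2] = perm_list [2, 6, 5, 3, 4, 1]"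
    by (simp add: perm_list_comp) (simp add: perm_list_eval)
  have e9: "perm_list [2, 6, 5, 3, 4, 1] \<circ> perm_list [4, 1, 6, 2, 3, 5] = perm_list [3, 2, 1, 6, 5, 4]"
    by (simp add: perm_list_comp) (simp add: perm_list_eval)
  have 2: "conj p2 = perm_list [5, 6, 1, 2, 3, 4]"
    unfolding conj_def invp unfolding p2_def e0 e1 ..
  have 32: "conj (p3 \<circ> p2) = perm_list [4, 1, 6, 2, 3, 5]"
    unfolding conj_comp[OF bij(2,1)] 2 invp unfolding p3_def e2 e3 ..
  have 432: "conj (p4 \<circ> (p3 \<circ> p2)) = perm_list [4, 3, 6, 5, 1, 2]"
    unfolding conj_comp[OF bij(3) bij_comp[OF bij(1,2)]] 32 invp unfolding p4_def e4 e5 ..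
  show "conj p2 \<circ> conj (p3 \<circ> p2) \<circ> conj p2 = p3"
    unfolding 2 32 e6 e7 unfolding p3_def ..
  show "conj (p3 \<circ> p2) \<circ> conj (p4 \<circ> (p3 \<circ> p2)) \<circ> conj (p3 \<circ> p2) = p4"
    unfolding 32 432 e8 e9 unfolding p4_def ..
qed

lemma reflection_group_H720: "reflection_group H720"
  unfolding H720_def
proof (rule reflection_groupI)
  \<comment> \<open>Taking all reflections of the group as generators makes every conjugate of
    \<open>b1\<close> by a group element available at once.\<close>
  let ?R = "{A \<in> carrier H720. reflection A}"
  let ?N = "generate unitary_group ?R"
  let ?conj = "\<lambda>g. g ** b1 ** inv\<^bsub>unitary_group\<^esub> g"
  show "?R \<subseteq> carrier (subgroup_generated unitary_group {b1, b2, b3, b4})"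
    by (auto simp: H720_def)
  have N: "A ** B \<in> ?N" if "A \<in> ?N" "B \<in> ?N" for A B
    using generate.eng[OF that] by simp
  have inv: "inv\<^bsub>unitary_group\<^esub> g \<in> carrier H720" if "g \<in> carrier H720" for g
    using that H720.inv_closed[OF that] unfolding H720_def by (simp add: U.inv_subgroup_generated)
  have conj_H720: "?conj g \<in> carrier H720" if "g \<in> carrier H720" for g
    using that b_in_H720(1) inv by (intro H720.m_closed)
  have conj: "?conj g \<in> ?N" if "g \<in> carrier H720" for g
    by (intro generate.incl CollectI conjI conj_H720[OF that] b1_reflection_conjugate H720_unitary that)
  have b1: "b1 \<in> ?N"
    using conj[OF H720.one_closed] unfolding U.inv_one matrix_mul_lid matrix_mul_rid .
  have b2: "b2 \<in> ?N"
    using N[OF N[OF b1 conj[OF b_in_H720(2)]] b1] unfolding inv_unitary_group[OF b_unitary(2)] b_braid .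
  have "- mat 1 \<in> ?N"
    using N[OF b2 b2] unfolding b2_square .
  then have neg: "- A \<in> ?N" if "A \<in> ?N" for A
    using N[OF _ that, of "- mat 1"] unfolding uminus_one_mult by blast
  have acts_conj: "acts (?conj g) (p \<circ> perm_list [2, 3, 1, 5, 6, 4] \<circ> inv' p)"
    if "acts g p" "g \<in> carrier H720" for g p
    using that by (intro acts_mult acts_b1 acts_inv H720_unitary)
  have from_perm: "B \<in> ?N" if "B \<in> carrier H720" "A \<in> carrier H720" "A \<in> ?N" "acts A p" "acts B p" for A B p
  proof -
    have "line_perm B = line_perm A"
      using line_perm_eqI[OF that(4)] line_perm_eqI[OF that(5)] by simp
    then have "B = A \<or> B = - A"
      by (rule line_perm_eq_imp[OF that(1,2)])
    then show ?thesis
      using that(3) neg[OF that(3)] by (elim disjE) simp_all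
  qed
  have b32: "b3 ** b2 \<in> carrier H720" "b4 ** (b3 ** b2) \<in> carrier H720"
    by (intro H720.m_closed b_in_H720)+
  have a32: "acts (b3 ** b2) (perm_list [1, 3, 2, 5, 4, 6] \<circ> perm_list [4, 2, 6, 1, 5, 3])"
    by (intro acts_mult acts_b2 acts_b3)
  have b3: "b3 \<in> ?N"
  proof (rule from_perm)
    show "acts (?conj b2 ** ?conj (b3 ** b2) ** ?conj b2) (perm_list [1, 3, 2, 5, 4, 6])"
      using acts_mult[OF acts_mult[OF acts_conj[OF acts_b2 b_in_H720(2)] acts_conj[OF a32 b32(1)]]
          acts_conj[OF acts_b2 b_in_H720(2)]]
      by (simp only: b3_b4_perms)
  qed (intro b_in_H720 acts_b3 N conj b32 H720.m_closed conj_H720)+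
  have b4: "b4 \<in> ?N"
  proof (rule from_perm)
    show "acts (?conj (b3 ** b2) ** ?conj (b4 ** (b3 ** b2)) ** ?conj (b3 ** b2)) (perm_list [3, 2, 1, 6, 5, 4])"
      using acts_mult[OF acts_mult[OF acts_conj[OF a32 b32(1)] acts_conj[OF acts_mult[OF acts_b4 a32] b32(2)]]
          acts_conj[OF a32 b32(1)]]
      by (simp only: b3_b4_perms)
  qed (intro b_in_H720 acts_b4 N conj b32 H720.m_closed conj_H720)+
  show "{b1, b2, b3, b4} \<subseteq> ?N"
    using b1 b2 b3 b4 by blast
qed simp

lemma reflection_group_complex_H24: "reflection_group (subgroup_generated unitary_group {c1, c2})"
proof (rule reflection_groupI)
  let ?K = "subgroup_generated unitary_group {c1, c2}"
  let ?R = "{c1, c2 ** c1 ** inv\<^bsub>unitary_group\<^esub> c2}"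
  have c: "c1 \<in> carrier ?K" "c2 \<in> carrier ?K"
    using c_unitary by (auto intro!: generators_in)
  interpret K: group ?K
    by (rule U.group_subgroup_generated)
  show "?R \<subseteq> carrier ?K"
    using c K.m_closed K.inv_closed[OF c(2)] by (simp add: U.inv_subgroup_generated)
  show "reflection A" if "A \<in> ?R" for A
    using that c1_reflection_conjugate[OF c_unitary(2)] c1_reflection_conjugate[OF U.one_closed]
    by (auto simp: U.inv_one)
  have "c1 ** (c2 ** c1 ** inv\<^bsub>unitary_group\<^esub> c2) ** c1 \<in> generate unitary_group ?R"
    using generate.eng[OF generate.eng[OF generate.incl generate.incl] generate.incl,
        of c1 ?R "c2 ** c1 ** inv\<^bsub>unitary_group\<^esub> c2" c1 unitary_group] by simp
  then show "{c1, c2} \<subseteq> generate unitary_group ?R"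
    using c_braid c_unitary(2) by (auto simp: inv_unitary_group intro: generate.incl)
qed

section \<open>The Shephard--Todd group number 4\<close>

lemma cis_pi_quarter: "cis (pi / 4) = Complex (sqrt 2 / 2) (sqrt 2 / 2)"
  by (simp add: cis.ctr cos_45 sin_45)

definition st4_s :: "complex ^ 2 ^ 2" where
  "st4_s = mat2 (Complex 0 (- 1)) 0 0 (Complex 0 1)"

text \<open>\<open>w\<close> is -\<omega>/2: the scalar -\<omega> of the number 4 case together with
  the factor 1/2 common to the entries of \<open>klein_T1\<close>.\<close>

definition st4_t :: "complex ^ 2 ^ 2" where
  "st4_t = (let w = Complex (1 / 4) (- (sqrt 3 / 4)) in
     mat2 (w * Complex 1 1) (w * Complex (- 1) 1) (w * Complex 1 1) (w * Complex 1 (- 1)))"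

lemma st4_s_eq: "mat (- 1) ** klein_S1 = st4_s"
  by (simp add: klein_S1_def st4_s_def mat_eq_mat2 mat2_mult mat2_eq_iff complex_eq_iff)

lemma klein_T1_eq:
  "klein_T1 = mat2 (Complex (1 / 2) (1 / 2)) (Complex (- 1 / 2) (1 / 2))
                   (Complex (1 / 2) (1 / 2)) (Complex (1 / 2) (- 1 / 2))"
proof -
  let ?e = "Complex (sqrt 2 / 2) (sqrt 2 / 2)"
  have e2: "?e * ?e = \<i>"
    by (simp add: complex_eq_iff)
  have "?e ^ 3 = (?e * ?e) * ?e" "?e ^ 7 = (?e * ?e) * (?e * ?e) * (?e * ?e) * ?e"
    by (simp_all add: eval_nat_numeral)
  then have "?e ^ 3 = \<i> * ?e" "?e ^ 7 = - \<i> * ?e"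
    unfolding e2 by simp_all
  then show ?thesis
    unfolding klein_T1_def cis_pi_quarter Let_def mat2_eq_iff
    by (simp add: complex_eq_iff Re_divide_of_real Im_divide_of_real)
qed

lemma st4_t_eq: "mat (- cis (2 * pi / 3)) ** klein_T1 = st4_t"
  unfolding klein_T1_eq st4_t_def mat_eq_mat2 mat2_mult mat2_eq_iff Let_def
  by (simp add: complex_eq_iff cos_120' sin_120' field_simps)

lemma shephard_todd_4_eq: "shephard_todd_4 = subgroup_generated unitary_group {st4_s, st4_t}"
  by (simp add: shephard_todd_4_def shephard_todd_tetrahedral_def st4_s_eq st4_t_eq)

lemma st4_unitary: "st4_s \<in> carrier unitary_group" "st4_t \<in> carrier unitary_group"
  unfolding unitary_iff st4_s_def st4_t_def cadjoint_mat2 mat2_mult mat_eq_mat2 mat2_eq_iff Let_def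
  by (simp_all add: complex_eq_iff conjugate_complex_def sqrt_simps algebra_simps)

text \<open>The rows of \<open>st4_conj\<close> are left eigenvectors of \<open>st4_t\<close>, scaled so that \<open>st4_s\<close> becomes
  \<open>c2\<^sup>-\<^sup>1\<close>.\<close>

definition st4_conj :: "complex ^ 2 ^ 2" where
  "st4_conj = mat2 2 (Complex (sqrt 3 - 1) (sqrt 3 - 1))
     (Complex 0 (sqrt 2 * (sqrt 3 - 1))) (Complex (sqrt 2) (- sqrt 2))"

text \<open>Generators go to inverses of generators, written as positive powers since
  \<open>c1\<close> and \<open>c2\<close> have orders 3 and 4. The first two relations serve one
  inclusion between the conjugated groups, the last two the other; the intertwining form avoids
  computing the inverse of \<open>st4_conj\<close>.\<close>

lemma st4_conj_relations:
  "st4_conj ** st4_s = (c2 ** c2 ** c2) ** st4_conj" "st4_conj ** st4_t = (c1 ** c1) ** st4_conj"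
  "st4_conj ** (st4_s ** st4_s ** st4_s) = c2 ** st4_conj" "st4_conj ** (st4_t ** st4_t) = c1 ** st4_conj"
  unfolding st4_conj_def st4_s_def st4_t_def c1_def c2_def mat2_mult mat2_eq_iff Let_def
  by (simp_all add: complex_eq_iff sqrt_simps field_simps)

lemma invertible_st4_conj: "invertible st4_conj"
proof -
  \<comment> \<open>The determinant is sqrt 2 (1 - i) (6 - 2 sqrt 3).\<close>
  have "sqrt 3 \<noteq> 3"
    by (rule notI, drule arg_cong[where f = "\<lambda>x. x * x"]) simp
  then show ?thesis
    unfolding invertible_det_nz det_2
    by (simp add: st4_conj_def complex_eq_iff sqrt_simps field_simps)
qed

text \<open>\<open>P\<close> need not be unitary, so the inverse case is not automatic: the
  conjugate of the inverse of \<open>h\<close> is a left inverse of \<open>P ** h ** Q\<close>,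
  which is unitary by hypothesis, and hence is its inverse in the unitary group.\<close>

lemma conjugate_generate:
  fixes S T :: "('a::involutive_div_algebra ^ 2 ^ 2) set"
  assumes "S \<subseteq> carrier unitary_group" "T \<subseteq> carrier unitary_group"
    and "P ** Q = mat 1" "Q ** P = mat 1"
    and "\<And>A. A \<in> S \<Longrightarrow> P ** A ** Q \<in> generate unitary_group T"
    and "A \<in> generate unitary_group S"
  shows "P ** A ** Q \<in> generate unitary_group T"
  using assms(6)
proof (induction A rule: generate.induct)
  have PQ: "(P ** A ** Q) ** (P ** B ** Q) = P ** (A ** B) ** Q" for A B
  proof -
    have "(P ** A ** Q) ** (P ** B ** Q) = P ** A ** (Q ** P) ** B ** Q"
      by (simp only: matrix_mul_assoc)
    then show ?thesis
      by (simp add: assms(4) matrix_mul_assoc)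
  qed
  {
    case one
    show ?case
      using generate.one[of unitary_group T] assms(3) by simp
  next
    case (incl h)
    then show ?case
      by (rule assms(5))
  next
    case (inv h)
    have h: "h \<in> carrier unitary_group"
      using inv assms(1) by blast
    have "P ** h ** Q \<in> carrier unitary_group"
      using U.generate_in_carrier[OF assms(2) assms(5)[OF inv]] .
    moreover have "P ** inv\<^bsub>unitary_group\<^esub> h ** Q ** (P ** h ** Q) = mat 1"
      unfolding PQ using h assms(3) by (simp add: U.l_inv)
    ultimately have "P ** inv\<^bsub>unitary_group\<^esub> h ** Q =
        (P ** inv\<^bsub>unitary_group\<^esub> h ** Q) ** ((P ** h ** Q) ** inv\<^bsub>unitary_group\<^esub> (P ** h ** Q))"
      by (simp add: U.r_inv)
    also have "\<dots> = ((P ** inv\<^bsub>unitary_group\<^esub> h ** Q) ** (P ** h ** Q)) **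
        inv\<^bsub>unitary_group\<^esub> (P ** h ** Q)"
      by (simp only: matrix_mul_assoc)
    also have "\<dots> = inv\<^bsub>unitary_group\<^esub> (P ** h ** Q)"
      unfolding \<open>P ** inv\<^bsub>unitary_group\<^esub> h ** Q ** (P ** h ** Q) = mat 1\<close> by simp
    finally show ?case
      using U.generate_m_inv_closed[OF assms(2) assms(5)[OF inv]] by simp
  next
    case (eng h1 h2)
    then show ?case
      using generate.eng[OF eng(3,4)] by (simp add: PQ)
  }
qed

lemma has_shephard_todd_number_4_H24:
  "has_shephard_todd_number_4 (subgroup_generated unitary_group {c1, c2})"
proof -
  let ?P = st4_conj and ?Q = "matrix_inv st4_conj"
  let ?G = "generate unitary_group {c1, c2}" and ?S = "generate unitary_group {st4_s, st4_t}"
  have PQ: "?P ** ?Q = mat 1" "?Q ** ?P = mat 1"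
  proof -
    have "?P ** ?Q = mat 1 \<and> ?Q ** ?P = mat 1"
      using invertible_st4_conj unfolding invertible_def matrix_inv_def by (rule someI_ex)
    then show "?P ** ?Q = mat 1" "?Q ** ?P = mat 1"
      by simp_all
  qed
  have conj: "?P ** A ** ?Q = B" "?Q ** B ** ?P = A" if "?P ** A = B ** ?P" for A B
    using that PQ by (metis matrix_mul_assoc matrix_mul_rid matrix_mul_lid)+
  have G: "A ** B \<in> ?G" if "A \<in> ?G" "B \<in> ?G" for A B
    using generate.eng[OF that] by simp
  have S: "A ** B \<in> ?S" if "A \<in> ?S" "B \<in> ?S" for A B
    using generate.eng[OF that] by simp
  have c: "c1 \<in> ?G" "c2 \<in> ?G" and st: "st4_s \<in> ?S" "st4_t \<in> ?S"
    by (simp_all add: generate.incl)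
  have "?P ** A ** ?Q \<in> ?G" if "A \<in> ?S" for A
  proof (rule conjugate_generate[OF _ _ PQ _ that])
    show "?P ** A ** ?Q \<in> ?G" if "A \<in> {st4_s, st4_t}" for A
      using that conj(1)[OF st4_conj_relations(1)] conj(1)[OF st4_conj_relations(2)] G c by auto
  qed (use st4_unitary c_unitary in auto)
  moreover have "?Q ** A ** ?P \<in> ?S" if "A \<in> ?G" for A
  proof (rule conjugate_generate[OF _ _ PQ(2,1) _ that])
    show "?Q ** A ** ?P \<in> ?S" if "A \<in> {c1, c2}" for A
      using that conj(2)[OF st4_conj_relations(3)] conj(2)[OF st4_conj_relations(4)] S st by auto
  qed (use st4_unitary c_unitary in auto)
  moreover have "A = ?P ** (?Q ** A ** ?P) ** ?Q" for A
  proof -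
    have "?P ** (?Q ** A ** ?P) ** ?Q = (?P ** ?Q) ** A ** (?P ** ?Q)"
      by (simp only: matrix_mul_assoc)
    then show ?thesis
      by (simp add: PQ)
  qed
  ultimately have "?G = (\<lambda>A. ?P ** A ** ?Q) ` ?S"
    by blast
  then show ?thesis
    unfolding has_shephard_todd_number_4_def shephard_todd_4_eq carrier_subgroup_generated
    using invertible_st4_conj st4_unitary c_unitary by (auto simp: Int_absorb1)
qed

section \<open>The orbit of the first coordinate line\<close>

text \<open>The slopes are 0 and the products of i sqrt 2 with the three cube roots of unity: the
  vertices of a regular tetrahedron on the Riemann sphere. The slope i sqrt 2 is that of the image
  of the first basis vector under \<open>c2\<close>.\<close>

definition four_vectors :: "(complex ^ 2) list" where
  "four_vectors =
     [vector [1, 0], vector [1, Complex 0 (sqrt 2)],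
      vector [1, Complex (- (sqrt 2 * sqrt 3 / 2)) (- (sqrt 2 / 2))],
      vector [1, Complex (sqrt 2 * sqrt 3 / 2) (- (sqrt 2 / 2))]]"

lemma distinct_four_vectors: "distinct four_vectors"
  by (simp add: four_vectors_def vector2_eq_iff complex_eq_iff)

lemma equiangular_four_lines: "equiangular (1 / 3) (line_of ` set four_vectors)"
  and inj_on_four_lines: "inj_on line_of (set four_vectors)"
proof -
  define N where "N v = (if v = vector [1, 0] then 1 else 3 :: real)" for v :: "complex ^ 2"
  have self: "hinner v v = of_real (N v)" if "v \<in> set four_vectors" for v
    using that unfolding four_vectors_def list.set insert_iff empty_iff
    by (elim disjE FalseE; hypsubst;
        simp add: N_def vector2_eq_iff hinner_vector2 conjugate_complex_def complex_eq_iff sqrt_simps;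
        (simp add: sqrt_simps algebra_simps)?)
  have angle: "(norm (hinner v w))\<^sup>2 = 1 / 3 * (N v * N w)"
    if "v \<in> set four_vectors" "w \<in> set four_vectors" "v \<noteq> w" for v w
    using that unfolding four_vectors_def list.set insert_iff empty_iff
    by (elim disjE FalseE; hypsubst; (erule notE, rule refl)?;
        simp add: N_def vector2_eq_iff hinner_vector2 conjugate_complex_def complex_eq_iff cmod_power2
          sqrt_simps; (simp add: power2_eq_square sqrt_simps algebra_simps)?)
  have "N v > 0" for v
    by (simp add: N_def)
  then show "equiangular (1 / 3) (line_of ` set four_vectors)" "inj_on line_of (set four_vectors)"
    using equiangular_line_of_image[of "set four_vectors" N "1 / 3"] self angle by simp_all
qed

lemma card_four_lines: "card (line_of ` set four_vectors) = 4"
  using card_image[OF inj_on_four_lines] distinct_card[OF distinct_four_vectors]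
  by (simp add: four_vectors_def)

lemma image_line_one:
  fixes A :: "'a::division_ring ^ 2 ^ 2"
  assumes "A *v v = vector [x, y]" "x \<noteq> 0" "y = z * x"
  shows "(*v) A ` line_of v = line_of (vector [1, z])"
proof -
  have "A *v v = rscale (vector [1, z]) x"
    using assms(1,3) by (simp add: rscale_vector2)
  then show ?thesis
    using assms(2) by (simp add: image_line_of line_of_rscale)
qed

definition four_line :: "nat \<Rightarrow> (complex ^ 2) set" where
  "four_line i = line_of (four_vectors ! i)"

lemma four_line_simps:
  "four_line 0 = line_of (vector [1, 0])" "four_line 1 = line_of (vector [1, Complex 0 (sqrt 2)])"
  "four_line 2 = line_of (vector [1, Complex (- (sqrt 2 * sqrt 3 / 2)) (- (sqrt 2 / 2))])"
  "four_line 3 = line_of (vector [1, Complex (sqrt 2 * sqrt 3 / 2) (- (sqrt 2 / 2))])"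
  by (simp_all add: four_line_def four_vectors_def eval_nat_numeral)

lemma four_lines_eq: "line_of ` set four_vectors = {four_line 0, four_line 1, four_line 2, four_line 3}"
  by (simp add: four_vectors_def four_line_def eval_nat_numeral)

lemma c_four_lines:
  "(*v) c1 ` four_line 0 = four_line 0" "(*v) c1 ` four_line 1 = four_line 2"
  "(*v) c1 ` four_line 2 = four_line 3" "(*v) c1 ` four_line 3 = four_line 1"
  "(*v) c2 ` four_line 0 = four_line 1" "(*v) c2 ` four_line 1 = four_line 0"
  "(*v) c2 ` four_line 2 = four_line 3" "(*v) c2 ` four_line 3 = four_line 2"
  unfolding four_line_simps
  by - (rule image_line_one, simp only: c1_def c2_def mat2_vector,
      simp add: complex_eq_iff sqrt_simps algebra_simps,
      simp add: complex_eq_iff sqrt_simps algebra_simps)+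

text \<open>Stability is stated as an equality, not an inclusion, so that it passes from a generator
  to its inverse.\<close>

lemma image_eq_generate:
  fixes S :: "('a::involutive_div_algebra ^ 2 ^ 2) set"
  assumes "S \<subseteq> carrier unitary_group" "\<And>A. A \<in> S \<Longrightarrow> (\<lambda>L. (*v) A ` L) ` F = F"
    and "A \<in> generate unitary_group S"
  shows "(\<lambda>L. (*v) A ` L) ` F = F"
  using assms(3)
proof (induction A rule: generate.induct)
  case one
  show ?case
    by (simp add: image_def)
next
  case (incl h)
  then show ?case
    by (rule assms(2))
next
  case (inv h)
  have h: "h \<in> carrier unitary_group"
    using inv assms(1) by blast
  have "(\<lambda>L. (*v) (inv\<^bsub>unitary_group\<^esub> h) ` L) ` F =
      (\<lambda>L. (*v) (inv\<^bsub>unitary_group\<^esub> h) ` L) ` (\<lambda>L. (*v) h ` L) ` F"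
    using assms(2)[OF inv] by simp
  also have "\<dots> = (\<lambda>L. (*v) (inv\<^bsub>unitary_group\<^esub> h ** h) ` L) ` F"
    by (simp add: image_image matrix_vector_mul_assoc)
  also have "\<dots> = F"
    using h by (simp add: U.l_inv image_def)
  finally show ?case .
next
  case (eng h1 h2)
  have "(\<lambda>L. (*v) (h1 ** h2) ` L) ` F = (\<lambda>L. (*v) h1 ` L) ` (\<lambda>L. (*v) h2 ` L) ` F"
    by (simp add: image_image matrix_vector_mul_assoc)
  then show ?case
    by (simp add: eng)
qed

lemma line_orbit_complex_H24:
  "line_orbit (subgroup_generated unitary_group {c1, c2}) (line_of (vector [1, 0])) =
     line_of ` set four_vectors"
proof
  let ?K = "subgroup_generated unitary_group {c1, c2}"
  have 0: "line_of (vector [1, 0]) = four_line 0"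
    by (simp add: four_line_def four_vectors_def)
  have stable: "(\<lambda>L. (*v) A ` L) ` (line_of ` set four_vectors) = line_of ` set four_vectors"
    if "A \<in> carrier ?K" for A
    using that unfolding carrier_subgroup_generated
  proof (rule image_eq_generate[rotated 2])
    show "(\<lambda>L. (*v) A ` L) ` (line_of ` set four_vectors) = line_of ` set four_vectors"
      if "A \<in> carrier unitary_group \<inter> {c1, c2}" for A
    proof -
      have "A = c1 \<or> A = c2"
        using that by blast
      then show ?thesis
        unfolding four_lines_eq image_insert image_empty by (elim disjE; simp only: c_four_lines; blast)
    qed
  qed auto
  have "four_line 0 \<in> line_of ` set four_vectors"
    unfolding four_lines_eq by simp
  then show "line_orbit ?K (line_of (vector [1, 0])) \<subseteq> line_of ` set four_vectors"
    unfolding 0 line_orbit_def using stable by blast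
  interpret K: group ?K
    by (rule U.group_subgroup_generated)
  have c: "c1 \<in> carrier ?K" "c2 \<in> carrier ?K"
    using c_unitary by (auto intro!: generators_in)
  have mult: "A ** B \<in> carrier ?K" if "A \<in> carrier ?K" "B \<in> carrier ?K" for A B
    using K.m_closed[OF that] by simp
  have step: "(*v) A ` L \<in> line_orbit ?K (four_line 0)" if A: "A \<in> carrier ?K" and L: "L \<in> line_orbit ?K (four_line 0)" for A L
  proof -
    obtain B where "B \<in> carrier ?K" "L = (*v) B ` four_line 0"
      using L by (auto simp: line_orbit_def)
    then show ?thesis
      unfolding line_orbit_def using mult[OF A]
      by (intro image_eqI[of _ _ "A ** B"]) (simp_all add: image_image matrix_vector_mul_assoc)
  qed
  have "mat 1 \<in> carrier ?K"
    using K.one_closed by simp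
  then have o0: "four_line 0 \<in> line_orbit ?K (four_line 0)"
    unfolding line_orbit_def by (intro image_eqI[of _ _ "mat 1"]) simp_all
  have o1: "four_line 1 \<in> line_orbit ?K (four_line 0)"
    using step[OF c(2) o0] by (simp only: c_four_lines)
  have o2: "four_line 2 \<in> line_orbit ?K (four_line 0)"
    using step[OF c(1) o1] by (simp only: c_four_lines)
  have o3: "four_line 3 \<in> line_orbit ?K (four_line 0)"
    using step[OF c(1) o2] by (simp only: c_four_lines)
  show "line_of ` set four_vectors \<subseteq> line_orbit ?K (line_of (vector [1, 0]))"
    unfolding 0 four_lines_eq using o0 o1 o2 o3 by blast
qed

theorem mainTheorem2:
  shows "{b1, b2, b3, b4} \<subseteq> carrier unitary_group
    \<and> irreducible_group H720 \<and> reflection_group H720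
    \<and> order H720 = 720 \<and> double_cover H720 (alt_group 6)
    \<and> (\<forall>v \<in> set six_vectors. \<forall>w \<in> set six_vectors. norm v = norm w)
    \<and> card six_lines = 6 \<and> equiangular (2 / 5) six_lines
    \<and> (\<forall>L \<in> six_lines. six_lines = line_orbit H720 L)
    \<and> subgroup (carrier H24) H720 \<and> order H24 = 24
    \<and> (\<forall>L \<in> six_lines. six_lines = line_orbit H24 L)
    \<and> carrier H24 = quat_matrix ` carrier (complex_matrices_of H24)
    \<and> reflection_group (complex_matrices_of H24)
    \<and> has_shephard_todd_number_4 (complex_matrices_of H24)
    \<and> (let Ls = line_orbit (complex_matrices_of H24) (line_of (vector [1, 0]))
       in card Ls = 4 \<and> (\<exists>angle. equiangular angle Ls))"
proof -
  have "card (line_of ` set four_vectors) = 4 \<and> (\<exists>angle. equiangular angle (line_of ` set four_vectors))"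
    using card_four_lines equiangular_four_lines by blast
  then show ?thesis
    unfolding Let_def complex_matrices_of_H24 line_orbit_complex_H24
    using b_unitary irreducible_H720 reflection_group_H720 order_H720 double_cover_H720
      norm_six_vectors card_six_lines equiangular_six_lines line_orbit_H720 H24_subgroup order_H24
      line_orbit_H24 carrier_H24 reflection_group_complex_H24 has_shephard_todd_number_4_H24
    by simp
qed

end
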